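(* Let $\kappa>0$ and $R>0$. For all $\epsilon\in(0,1]$, $\delta\in(0,1/2]$, $\alpha\in(0,1/2]$, there is an $\alpha$-accurate $(\epsilon,\delta)$-DP sampler for the class $\{\mathsf{N}(\mu,\Sigma)\mid I\preceq\Sigma\preceq\kappa I,\ \|\mu\|\le R\}$ with sample complexity $$n=O\left(\left(R^2+\kappa^2 d\left(\log\left(\frac{d}{\alpha\epsilon}\right)+\log\log(1/\delta)\right)\right)\cdot\frac{d^{1/2}}{\alpha}\cdot\frac{\log(1/\delta)}{\epsilon^2}\right).$$
   Context: $\|\cdot\|$ is the Euclidean norm; $A\preceq B$ means $B-A$ is positive semidefinite. $\mathsf{N}(\mu,\Sigma)$ is the Gaussian with density proportional to $\exp(-\frac12(x-\mu)^T\Sigma^{-1}(x-\mu))$. A sampler with sample complexity $n$ for a class $\mathcal{D}$ is an algorithm $\mathcal{A}$ receiving $n$ i.i.d. samples $\mathbf{X}\sim D^n$ from an unknown $D\in\mathcal{D}$ and outputting one point; with $Q_{\mathcal{A},D}$ its output distribution, it is $\alpha$-accurate if $d_{\mathrm{tv}}(D,Q_{\mathcal{A},D})\le\alpha$ for all $D\in\mathcal{D}$. Datasets are neighbors if they have the same size and differ in one element. $\mathcal{M}$ is $(\epsilon,\delta)$-DP if for all neighbors $Y,Y'$ and output sets $S$, $\Pr[\mathcal{M}(Y)\in S]\le e^\epsilon\Pr[\mathcal{M}(Y')\in S]+\delta$. *)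

theory Defs
  imports "HOL-Probability.Probability" "Jordan_Normal_Form.Gauss_Jordan_Elimination"
begin

text \<open>
  The dimension is quantified inside the theorem, below the constant hidden in the O-notation, so it
  cannot be a type.  Points of d-dimensional space are functions on \<open>{..<d}\<close>, extended by
  \<open>undefined\<close>, and matrices are those of \<^theory>\<open>Jordan_Normal_Form.Matrix\<close>.  Both that theory
  and HOL-Analysis define a constant \<open>vec\<close> and a type \<open>vec\<close>, hence the qualified names.
\<close>

type_synonym point = "nat \<Rightarrow> real"

abbreviation Rd :: "nat \<Rightarrow> point measure" where
  "Rd d \<equiv> PiM {..<d} (\<lambda>_. borel)"

abbreviation lborel_Rd :: "nat \<Rightarrow> point measure" where
  "lborel_Rd d \<equiv> PiM {..<d} (\<lambda>_. lborel)"

definition psd :: "nat \<Rightarrow> real mat \<Rightarrow> bool" where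
  "psd d A \<longleftrightarrow> A \<in> carrier_mat d d \<and> transpose_mat A = A \<and>
     (\<forall>v\<in>carrier_vec d. 0 \<le> scalar_prod v (A *\<^sub>v v))"

definition loewner_le :: "nat \<Rightarrow> real mat \<Rightarrow> real mat \<Rightarrow> bool" where
  "loewner_le d A B \<longleftrightarrow> A \<in> carrier_mat d d \<and> B \<in> carrier_mat d d \<and> psd d (B - A)"

definition gaussian_weight :: "nat \<Rightarrow> point \<Rightarrow> real mat \<Rightarrow> point \<Rightarrow> real" where
  "gaussian_weight d \<mu> \<Sigma> x =
     (let v = Matrix.vec d (\<lambda>i. x i - \<mu> i)
      in exp (- (1 / 2) * scalar_prod v (the (mat_inverse \<Sigma>) *\<^sub>v v)))"

text \<open>Meaningful for positive definite \<open>\<Sigma>\<close> only.\<close>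

definition gaussian :: "nat \<Rightarrow> point \<Rightarrow> real mat \<Rightarrow> point measure" where
  "gaussian d \<mu> \<Sigma> = density (lborel_Rd d)
     (\<lambda>x. ennreal (gaussian_weight d \<mu> \<Sigma> x /
                    (\<integral>y. gaussian_weight d \<mu> \<Sigma> y \<partial>lborel_Rd d)))"

definition gaussian_class :: "nat \<Rightarrow> real \<Rightarrow> real \<Rightarrow> point measure set" where
  "gaussian_class d \<kappa> R =
     {gaussian d \<mu> \<Sigma> | \<mu> \<Sigma>.
        \<mu> \<in> space (Rd d) \<and> \<Sigma> \<in> carrier_mat d d \<and>
        loewner_le d (1\<^sub>m d) \<Sigma> \<and> loewner_le d \<Sigma> (\<kappa> \<cdot>\<^sub>m 1\<^sub>m d) \<and>
        L2_set \<mu> {..<d} \<le> R}"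

definition tv_dist :: "'a measure \<Rightarrow> 'a measure \<Rightarrow> real" where
  "tv_dist P Q = (SUP S\<in>sets P. \<bar>measure P S - measure Q S\<bar>)"

text \<open>
  A randomized algorithm is a Markov kernel: it maps a dataset of size \<open>n\<close> over \<open>X\<close> to the
  distribution of its output in \<open>X\<close>.
\<close>

definition sampler :: "'a measure \<Rightarrow> nat \<Rightarrow> ((nat \<Rightarrow> 'a) \<Rightarrow> 'a measure) \<Rightarrow> bool" where
  "sampler X n A \<longleftrightarrow> A \<in> PiM {..<n} (\<lambda>_. X) \<rightarrow>\<^sub>M prob_algebra X"

definition output_dist :: "nat \<Rightarrow> ((nat \<Rightarrow> 'a) \<Rightarrow> 'a measure) \<Rightarrow> 'a measure \<Rightarrow> 'a measure" where
  "output_dist n A D = Giry_Monad.bind (PiM {..<n} (\<lambda>_. D)) A"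

definition accurate ::
  "'a measure set \<Rightarrow> nat \<Rightarrow> real \<Rightarrow> ((nat \<Rightarrow> 'a) \<Rightarrow> 'a measure) \<Rightarrow> bool" where
  "accurate \<D> n \<alpha> A \<longleftrightarrow> (\<forall>D\<in>\<D>. tv_dist D (output_dist n A D) \<le> \<alpha>)"

definition neighbors :: "nat \<Rightarrow> (nat \<Rightarrow> 'a) \<Rightarrow> (nat \<Rightarrow> 'a) \<Rightarrow> bool" where
  "neighbors n Y Y' \<longleftrightarrow> card {i\<in>{..<n}. Y i \<noteq> Y' i} = 1"

definition diff_private ::
  "'a measure \<Rightarrow> nat \<Rightarrow> real \<Rightarrow> real \<Rightarrow> ((nat \<Rightarrow> 'a) \<Rightarrow> 'a measure) \<Rightarrow> bool" where
  "diff_private X n \<epsilon> \<delta> A \<longleftrightarrow>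
     (\<forall>Y\<in>space (PiM {..<n} (\<lambda>_. X)). \<forall>Y'\<in>space (PiM {..<n} (\<lambda>_. X)). neighbors n Y Y' \<longrightarrow>
        (\<forall>S\<in>sets X. measure (A Y) S \<le> exp \<epsilon> * measure (A Y') S + \<delta>))"

end

theory Submission
  imports Defs "Jordan_Normal_Form.Determinant"
begin

text \<open>
  Idea: take \<open>n = m\<^sup>2\<close> samples and signs \<open>a\<^sub>j = \<plusminus>1/m\<close> with \<open>\<Sum>a\<^sub>j = 1\<close> and \<open>\<Sum>a\<^sub>j\<^sup>2 = 1\<close>.  Then
  \<open>\<Sum>a\<^sub>j X\<^sub>j\<close> is again distributed as \<open>N(\<mu>, \<Sigma>)\<close>, while a single sample has influence only \<open>1/m\<close> on
  it.  Replacing samples of large norm by 0 bounds the sensitivity, and adding \<open>N(0, \<sigma>\<^sup>2 I)\<close> with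
  \<open>\<sigma>\<^sup>2 = \<alpha> / (4 \<surd>d)\<close> makes the output private.  The added noise costs little accuracy: the
  chi-square divergence of \<open>N(\<mu>, \<Sigma>) * N(0, \<sigma>\<^sup>2 I)\<close> from \<open>N(\<mu>, \<Sigma>)\<close> is
  \<open>E exp (Z \<bullet> \<Sigma>\<^sup>-\<^sup>1 Z') - 1\<close> for independent \<open>Z, Z' \<sim> N(0, \<sigma>\<^sup>2 I)\<close>, which is of order \<open>d \<sigma>\<^sup>4\<close> because
  \<open>\<Sigma>\<^sup>-\<^sup>1 \<preceq> I\<close>.  Everything is expressed through the quadratic form of \<open>\<Sigma>\<^sup>-\<^sup>1\<close>, so that no
  diagonalisation or determinant of \<open>\<Sigma>\<close> is needed.
\<close>

section \<open>Integration on \<open>\<real>\<^sup>d\<close>\<close>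

text \<open>Sample size: a replaced sample moves the centre of the noise by squared distance at most
  \<open>4 * b / n\<close>, where \<open>b\<close> bounds the squared norms after truncation, and
  the noise hides a squared shift of \<open>\<sigma>\<^sup>2 * \<epsilon>\<^sup>2 / (8 * ln (1 /
  \<delta>))\<close>. So \<open>n\<close> has to exceed a multiple of \<open>b * ln (1 / \<delta>) /
  (\<sigma>\<^sup>2 * \<epsilon>\<^sup>2)\<close>, and the largest admissible \<sigma> is wanted.
  Total variation is bounded by the root of the chi-square divergence, hence by a multiple of
  \<open>sqrt d * \<sigma>\<^sup>2\<close>; making this of order \<alpha> fixes \<sigma> and yields
  the factor \<open>sqrt d / \<alpha>\<close>. The obstacle is a circularity: truncation must spare
  all \<open>n\<close> samples at once, so \<open>b\<close> contains \<open>ln n\<close>, while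
  \<open>n\<close> is proportional to \<open>b\<close>. The bound has room for this logarithm
  because it grows with \<kappa>^2, whereas \<open>b\<close> carries only one factor \<kappa> in
  front of the logarithm.\<close>

lemma nn_integral_lborel_Rd_affine:
  fixes c :: real and t :: "nat \<Rightarrow> real"
  assumes c: "c \<noteq> 0" and f[measurable]: "f \<in> borel_measurable (Rd d)"
  shows "(\<integral>\<^sup>+x. f x \<partial>lborel_Rd d) =
    ennreal (\<bar>c\<bar> ^ d) * (\<integral>\<^sup>+x. f (\<lambda>i\<in>{..<d}. t i + c * x i) \<partial>lborel_Rd d)"
proof -
  interpret product_sigma_finite "\<lambda>_::nat. lborel :: real measure" ..
  let ?T = "\<lambda>x. \<lambda>i\<in>{..<d}. t i + c * x i"
  have T[measurable]: "?T \<in> lborel_Rd d \<rightarrow>\<^sub>M Rd d"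
    by measurable
  \<comment> \<open>A product measure is determined by its values on boxes, where the Jacobian
    splits into one factor \<open>\<bar>c\<bar>\<close> per coordinate.\<close>
  have "density (distr (lborel_Rd d) (Rd d) ?T) (\<lambda>_. ennreal (\<bar>c\<bar> ^ d)) = lborel_Rd d"
  proof (rule PiM_eqI)
    show "sets (density (distr (lborel_Rd d) (Rd d) ?T) (\<lambda>_. ennreal (\<bar>c\<bar> ^ d))) = sets (lborel_Rd d)"
      by (simp cong: sets_PiM_cong)
  next
    fix A :: "nat \<Rightarrow> real set"
    assume A: "\<And>i. i \<in> {..<d} \<Longrightarrow> A i \<in> sets lborel"
    let ?B = "\<lambda>i. (\<lambda>x. t i + c * x) -` A i"
    have B: "?B i \<in> sets borel" if "i < d" for i
      using measurable_sets[of "\<lambda>x. t i + c * x" borel borel "A i"] A[of i] that by simp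
    have m: "emeasure lborel (A i) = ennreal \<bar>c\<bar> * emeasure lborel (?B i)" if "i < d" for i
    proof -
      have Ai[measurable]: "A i \<in> sets borel"
        using A that by simp
      have "emeasure lborel (A i) = emeasure (density (distr lborel borel (\<lambda>x. t i + c * x)) (\<lambda>_. ennreal \<bar>c\<bar>)) (A i)"
        using lborel_real_affine[OF c, of "t i"] by simp
      also have "\<dots> = ennreal \<bar>c\<bar> * emeasure lborel (?B i)"
        by (simp add: emeasure_density emeasure_distr nn_integral_cmult_indicator)
      finally show ?thesis .
    qed
    have PA: "Pi\<^sub>E {..<d} A \<in> sets (Rd d)"
      using A by (intro sets_PiM_I_finite) auto
    have "?T -` Pi\<^sub>E {..<d} A \<inter> space (lborel_Rd d) = Pi\<^sub>E {..<d} ?B"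
      by (auto simp: space_PiM PiE_iff extensional_def split: if_splits)
    then have "emeasure (distr (lborel_Rd d) (Rd d) ?T) (Pi\<^sub>E {..<d} A) = emeasure (lborel_Rd d) (Pi\<^sub>E {..<d} ?B)"
      using PA by (simp add: emeasure_distr)
    also have "\<dots> = (\<Prod>i<d. emeasure lborel (?B i))"
      using B by (intro emeasure_PiM) auto
    finally have "emeasure (density (distr (lborel_Rd d) (Rd d) ?T) (\<lambda>_. ennreal (\<bar>c\<bar> ^ d))) (Pi\<^sub>E {..<d} A)
       = ennreal (\<bar>c\<bar> ^ d) * (\<Prod>i<d. emeasure lborel (?B i))"
      using PA by (simp add: emeasure_density nn_integral_cmult_indicator)
    also have "\<dots> = (\<Prod>i<d. ennreal \<bar>c\<bar> * emeasure lborel (?B i))"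
      by (simp add: prod.distrib ennreal_power)
    also have "\<dots> = (\<Prod>i\<in>{..<d}. emeasure lborel (A i))"
      using m by (intro prod.cong) auto
    finally show "emeasure (density (distr (lborel_Rd d) (Rd d) ?T) (\<lambda>_. ennreal (\<bar>c\<bar> ^ d))) (Pi\<^sub>E {..<d} A)
       = (\<Prod>i\<in>{..<d}. emeasure lborel (A i))" .
  qed simp
  then have "(\<integral>\<^sup>+x. f x \<partial>lborel_Rd d) =
      (\<integral>\<^sup>+x. f x \<partial>density (distr (lborel_Rd d) (Rd d) ?T) (\<lambda>_. ennreal (\<bar>c\<bar> ^ d)))"
    by simp
  also have "\<dots> = ennreal (\<bar>c\<bar> ^ d) * (\<integral>\<^sup>+x. f (?T x) \<partial>lborel_Rd d)"
    by (simp add: nn_integral_density nn_integral_distr nn_integral_cmult)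
  finally show ?thesis .
qed

lemma nn_integral_lborel_Rd_shift:
  fixes t :: "nat \<Rightarrow> real"
  assumes "f \<in> borel_measurable (Rd d)"
  shows "(\<integral>\<^sup>+x. f (\<lambda>i\<in>{..<d}. x i + t i) \<partial>lborel_Rd d) = (\<integral>\<^sup>+x. f x \<partial>lborel_Rd d)"
  using nn_integral_lborel_Rd_affine[of 1 f d t] assms by (simp add: add.commute)

text \<open>The integrand is split by \<open>2 \<bar>g - 1\<bar> \<le> c + (g - 1)\<^sup>2 / c\<close>, which replaces Cauchy-Schwarz.\<close>

lemma (in prob_space) abs_measure_diff_density_le:
  fixes h :: "'a \<Rightarrow> ennreal"
  assumes h[measurable]: "h \<in> borel_measurable M"
    and h1: "(\<integral>\<^sup>+x. h x \<partial>M) = 1" and h2: "(\<integral>\<^sup>+x. h x * h x \<partial>M) \<le> ennreal (1 + c\<^sup>2)"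
    and c: "c > 0" and S[measurable]: "S \<in> sets M"
  shows "\<bar>measure M S - measure (density M h) S\<bar> \<le> c"
proof -
  \<comment> \<open>The integral of \<open>h\<close> is 1, so \<open>h\<close> is finite almost
    everywhere and \<open>g\<close> loses nothing; for real values the square
    \<open>(g x - 1)\<^sup>2\<close> can be expanded and integrated termwise.\<close>
  define g where "g x = enn2real (h x)" for x
  have g[measurable]: "g \<in> borel_measurable M"
    unfolding g_def by measurable
  have g0: "g x \<ge> 0" for x
    by (simp add: g_def)
  have hg: "AE x in M. h x = ennreal (g x)"
    using nn_integral_noteq_infinite[of h M] h1 by (auto simp: g_def less_top)
  have n1: "(\<integral>\<^sup>+x. ennreal (g x) \<partial>M) = 1"
    using h1 hg nn_integral_cong_AE[of h "\<lambda>x. ennreal (g x)" M] by simp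
  have "(\<integral>\<^sup>+x. ennreal (g x * g x) \<partial>M) = (\<integral>\<^sup>+x. h x * h x \<partial>M)"
    using hg by (intro nn_integral_cong_AE) (auto simp: ennreal_mult g0)
  then have n2: "(\<integral>\<^sup>+x. ennreal (g x * g x) \<partial>M) \<le> ennreal (1 + c\<^sup>2)"
    using h2 by simp
  have i1: "integrable M g" and v1: "(\<integral>x. g x \<partial>M) = 1"
    using nn_integral_eq_integrable[of g M 1] n1 g0 by auto
  have i2: "integrable M (\<lambda>x. g x * g x)"
    using n2 g0 by (intro integrableI_bounded) (auto intro: le_less_trans)
  have v2: "(\<integral>x. g x * g x \<partial>M) \<le> 1 + c\<^sup>2"
    using n2 nn_integral_eq_integral[OF i2] g0 by (simp add: ennreal_le_iff del: ennreal_plus)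
  have eq: "(g x - 1)\<^sup>2 = g x * g x - 2 * g x + 1" for x
    by (simp add: power2_eq_square algebra_simps)
  have v3: "(\<integral>x. (g x - 1)\<^sup>2 \<partial>M) \<le> c\<^sup>2" and i3: "integrable M (\<lambda>x. (g x - 1)\<^sup>2)"
    using i1 i2 v1 v2 by (simp_all add: eq prob_space)
  have "emeasure (density M h) S = (\<integral>\<^sup>+x. ennreal (g x * indicator S x) \<partial>M)"
    using hg by (subst emeasure_density) (auto intro!: nn_integral_cong_AE simp: indicator_def)
  also have iS: "integrable M (\<lambda>x. g x * indicator S x)"
    using i1 by (intro integrable_real_mult_indicator) auto
  then have "(\<integral>\<^sup>+x. ennreal (g x * indicator S x) \<partial>M) = ennreal (\<integral>x. g x * indicator S x \<partial>M)"
    by (intro nn_integral_eq_integral) (auto simp: g0)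
  finally have "measure (density M h) S = (\<integral>x. g x * indicator S x \<partial>M)"
    by (simp add: measure_def g0)
  moreover have "measure M S = (\<integral>x. indicator S x \<partial>M)"
    by simp
  ultimately have "measure M S - measure (density M h) S = (\<integral>x. indicator S x - g x * indicator S x \<partial>M)"
    using iS by (subst Bochner_Integration.integral_diff) (auto simp: less_top[symmetric])
  also have "\<bar>\<dots>\<bar> \<le> (\<integral>x. \<bar>indicator S x - g x * indicator S x\<bar> \<partial>M)"
    by (rule integral_abs_bound)
  also have "\<dots> \<le> (\<integral>x. (c + (g x - 1)\<^sup>2 / c) / 2 \<partial>M)"
  proof (rule integral_mono)
    show "integrable M (\<lambda>x. \<bar>indicator S x - g x * indicator S x\<bar>)"
      using iS by (intro integrable_abs Bochner_Integration.integrable_diff) (auto simp: less_top[symmetric])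
    show "integrable M (\<lambda>x. (c + (g x - 1)\<^sup>2 / c) / 2)"
      using i3 by auto
    fix x
    have "0 \<le> (\<bar>g x - 1\<bar> - c)\<^sup>2 / c"
      using c by simp
    also have "\<dots> = (c + (g x - 1)\<^sup>2 / c) - 2 * \<bar>g x - 1\<bar>"
      using c by (simp add: power2_eq_square field_simps)
    finally have "\<bar>g x - 1\<bar> \<le> (c + (g x - 1)\<^sup>2 / c) / 2"
      by simp
    moreover have "0 \<le> (c + (g x - 1)\<^sup>2 / c) / 2"
      using c by simp
    ultimately show "\<bar>indicator S x - g x * indicator S x\<bar> \<le> (c + (g x - 1)\<^sup>2 / c) / 2"
      by (auto simp: indicator_def abs_minus_commute)
  qed
  also have "\<dots> = (c + (\<integral>x. (g x - 1)\<^sup>2 \<partial>M) / c) / 2"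
    using i3 by (simp add: prob_space)
  also have "\<dots> \<le> (c + c\<^sup>2 / c) / 2"
    using v3 c by (intro divide_right_mono add_left_mono) auto
  also have "\<dots> = c"
    using c by (simp add: power2_eq_square)
  finally show ?thesis .
qed

text \<open>Lets the measurability prover reach the coordinates of a sample inside a dataset, which
  is a function into functions.\<close>

lemma borel_measurable_nested_component[measurable (raw)]:
  "k \<in> J \<Longrightarrow> i < d \<Longrightarrow> (\<lambda>Y. Y k i) \<in> borel_measurable (PiM J (\<lambda>_. Rd d))"
  using measurable_compose[of "\<lambda>Y. Y k" "PiM J (\<lambda>_. Rd d)" "Rd d" "\<lambda>x. x i" borel] by simp

section \<open>Gaussians given by a quadratic form\<close>

lemma nn_integral_exp_neg_square_finite:
  fixes v :: real
  assumes "v > 0"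
  shows "(\<integral>\<^sup>+x. ennreal (exp (- x\<^sup>2 / (2 * v))) \<partial>lborel) < \<infinity>"
proof -
  have "(\<integral>\<^sup>+x. ennreal (exp (- x\<^sup>2 / (2 * v))) \<partial>lborel)
      = (\<integral>\<^sup>+x. ennreal (sqrt (2 * pi * v)) * ennreal (normal_density 0 (sqrt v) x) \<partial>lborel)"
    using assms by (intro nn_integral_cong) (simp add: normal_density_def ennreal_mult[symmetric] del: real_sqrt_mult)
  also have "\<dots> = ennreal (sqrt (2 * pi * v)) * (\<integral>\<^sup>+x. ennreal (normal_density 0 (sqrt v) x) \<partial>lborel)"
    by (rule nn_integral_cmult) simp
  also have "(\<integral>\<^sup>+x. ennreal (normal_density 0 (sqrt v) x) \<partial>lborel) = 1"
    using assms by (subst nn_integral_eq_integral) auto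
  finally show ?thesis
    by (simp add: ennreal_mult_less_top)
qed

text \<open>\<open>Q\<close> plays the role of \<open>\<Sigma>\<^sup>-\<^sup>1\<close>.\<close>

locale quadratic_form =
  fixes d :: nat and Q :: "nat \<Rightarrow> nat \<Rightarrow> real" and \<kappa> :: real
  assumes sym: "i < d \<Longrightarrow> j < d \<Longrightarrow> Q i j = Q j i"
    and kappa_pos: "\<kappa> > 0"
    and sum_squares_le: "(\<Sum>i<d. (x i)\<^sup>2) \<le> \<kappa> * (\<Sum>i<d. \<Sum>j<d. x i * Q i j * x j)"
    and contraction: "(\<Sum>i<d. (\<Sum>j<d. Q i j * x j)\<^sup>2) \<le> (\<Sum>i<d. (x i)\<^sup>2)"
begin

definition bil :: "(nat \<Rightarrow> real) \<Rightarrow> (nat \<Rightarrow> real) \<Rightarrow> real" where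
  "bil x y = (\<Sum>i<d. \<Sum>j<d. x i * Q i j * y j)"

lemma bil_commute: "bil x y = bil y x"
proof -
  have "bil x y = (\<Sum>j<d. \<Sum>i<d. x i * Q i j * y j)"
    unfolding bil_def by (rule sum.swap)
  also have "\<dots> = bil y x"
    unfolding bil_def by (intro sum.cong refl) (simp add: sym)
  finally show ?thesis .
qed

lemma bil_add_left: "bil (\<lambda>i. x i + y i) z = bil x z + bil y z"
  by (simp add: bil_def distrib_right sum.distrib)

lemma bil_diff_left: "bil (\<lambda>i. x i - y i) z = bil x z - bil y z"
  by (simp add: bil_def left_diff_distrib sum_subtractf)

lemma bil_scale_left: "bil (\<lambda>i. c * x i) z = c * bil x z"
  by (simp add: bil_def sum_distrib_left mult.assoc)

lemma bil_add_right: "bil z (\<lambda>i. x i + y i) = bil z x + bil z y"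
  by (simp add: bil_commute[of z] bil_add_left)

lemma bil_diff_right: "bil z (\<lambda>i. x i - y i) = bil z x - bil z y"
  by (simp add: bil_commute[of z] bil_diff_left)

lemma bil_scale_right: "bil z (\<lambda>i. c * x i) = c * bil z x"
  by (simp add: bil_commute[of z] bil_scale_left)

lemmas bil_linear = bil_add_left bil_diff_left bil_scale_left bil_add_right bil_diff_right bil_scale_right

lemma bil_cong: "(\<And>i. i < d \<Longrightarrow> x i = x' i) \<Longrightarrow> (\<And>i. i < d \<Longrightarrow> y i = y' i) \<Longrightarrow> bil x y = bil x' y'"
  by (simp add: bil_def)

lemma norm_le_bil: "(\<Sum>i<d. (x i)\<^sup>2) \<le> \<kappa> * bil x x"
  using sum_squares_le by (simp add: bil_def)

lemma borel_measurable_bil[measurable]: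
  assumes "\<And>i. i < d \<Longrightarrow> (\<lambda>x. f x i) \<in> borel_measurable M" "\<And>i. i < d \<Longrightarrow> (\<lambda>x. g x i) \<in> borel_measurable M"
  shows "(\<lambda>x. bil (f x) (g x)) \<in> borel_measurable M"
  unfolding bil_def
  by (intro borel_measurable_sum borel_measurable_times borel_measurable_const assms) auto

text \<open>Unnormalised density of N(m, s \<Sigma>). The scale \<open>s\<close> is a parameter
  because scaling, summation and the tail bound all leave the covariance \<Sigma> but stay among its
  multiples.\<close>

definition weight :: "(nat \<Rightarrow> real) \<Rightarrow> real \<Rightarrow> point \<Rightarrow> real" where
  "weight m s x = exp (- bil (\<lambda>i. x i - m i) (\<lambda>i. x i - m i) / (2 * s))"

lemma weight_cong: "(\<And>i. i < d \<Longrightarrow> x i - m i = x' i - m' i) \<Longrightarrow> weight m s x = weight m' s x'"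
  unfolding weight_def by (intro arg_cong[where f=exp] arg_cong2[where f="(/)"] arg_cong[where f=uminus] bil_cong) auto

lemma weight_pos: "weight m s x > 0"
  by (simp add: weight_def)

lemma borel_measurable_weight[measurable]:
  assumes "\<And>i. i < d \<Longrightarrow> (\<lambda>x. f x i) \<in> borel_measurable M" "\<And>i. i < d \<Longrightarrow> (\<lambda>x. g x i) \<in> borel_measurable M"
  shows "(\<lambda>x. weight (f x) s (g x)) \<in> borel_measurable M"
  unfolding weight_def
  by (intro measurable_compose[OF _ borel_measurable_exp] borel_measurable_divide borel_measurable_uminus borel_measurable_bil
      borel_measurable_const borel_measurable_diff assms borel_measurable_times) auto

definition Z :: "real \<Rightarrow> ennreal" where
  "Z s = (\<integral>\<^sup>+x. ennreal (weight (\<lambda>_. 0) s x) \<partial>lborel_Rd d)"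

lemma nn_integral_weight: "(\<integral>\<^sup>+x. ennreal (weight m s x) \<partial>lborel_Rd d) = Z s"
proof -
  have "Z s = (\<integral>\<^sup>+x. ennreal (weight (\<lambda>_. 0) s (\<lambda>i\<in>{..<d}. x i + - m i)) \<partial>lborel_Rd d)"
    unfolding Z_def by (rule nn_integral_lborel_Rd_shift[symmetric]) measurable
  also have "\<dots> = (\<integral>\<^sup>+x. ennreal (weight m s x) \<partial>lborel_Rd d)"
    by (intro nn_integral_cong arg_cong[where f=ennreal] weight_cong) simp
  finally show ?thesis ..
qed

text \<open>Stands in for the determinant formula: only a ratio of two normalisers is ever
  evaluated, and a linear substitution supplies it.\<close>

lemma Z_scale:
  assumes "c > 0"
  shows "Z (c\<^sup>2 * s) = ennreal (c ^ d) * Z s"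
proof -
  have "Z (c\<^sup>2 * s) = ennreal (\<bar>c\<bar> ^ d) * (\<integral>\<^sup>+x. ennreal (weight (\<lambda>_. 0) (c\<^sup>2 * s) (\<lambda>i\<in>{..<d}. 0 + c * x i)) \<partial>lborel_Rd d)"
    unfolding Z_def using assms by (intro nn_integral_lborel_Rd_affine) auto
  also have "(\<integral>\<^sup>+x. ennreal (weight (\<lambda>_. 0) (c\<^sup>2 * s) (\<lambda>i\<in>{..<d}. 0 + c * x i)) \<partial>lborel_Rd d) = Z s"
    unfolding Z_def
  proof (intro nn_integral_cong arg_cong[where f=ennreal])
    fix x :: point
    have "weight (\<lambda>_. 0) (c\<^sup>2 * s) (\<lambda>i\<in>{..<d}. 0 + c * x i) = weight (\<lambda>_. 0) (c\<^sup>2 * s) (\<lambda>i. c * x i)"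
      by (rule weight_cong) simp
    also have "\<dots> = weight (\<lambda>_. 0) s x"
      using assms by (simp add: weight_def bil_linear power2_eq_square)
    finally show "weight (\<lambda>_. 0) (c\<^sup>2 * s) (\<lambda>i\<in>{..<d}. 0 + c * x i) = weight (\<lambda>_. 0) s x" .
  qed
  finally show ?thesis
    using assms by simp
qed

text \<open>Since \<open>Q\<close> dominates the identity divided by \<kappa>, the weight lies below
  that of a spherical Gaussian of variance \<open>\<kappa> * s\<close>, whose integral is a product
  of one-dimensional ones.\<close>

lemma Z_finite:
  assumes "s > 0"
  shows "Z s < \<infinity>"
proof -
  interpret product_sigma_finite "\<lambda>_::nat. lborel :: real measure" ..
  have "Z s \<le> (\<integral>\<^sup>+x. (\<Prod>i<d. ennreal (exp (- (x i)\<^sup>2 / (2 * (\<kappa> * s))))) \<partial>lborel_Rd d)"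
    unfolding Z_def
  proof (intro nn_integral_mono)
    fix x :: point
    have "(\<Sum>i<d. (x i)\<^sup>2) / (2 * (\<kappa> * s)) \<le> (\<kappa> * bil x x) / (2 * (\<kappa> * s))"
      using norm_le_bil[of x] kappa_pos assms by (intro divide_right_mono) auto
    also have "\<dots> = bil x x / (2 * s)"
      using kappa_pos by simp
    finally have "weight (\<lambda>_. 0) s x \<le> exp (- (\<Sum>i<d. (x i)\<^sup>2) / (2 * (\<kappa> * s)))"
      by (simp add: weight_def)
    also have "\<dots> = (\<Prod>i<d. exp (- (x i)\<^sup>2 / (2 * (\<kappa> * s))))"
      by (simp add: exp_sum[symmetric] sum_divide_distrib sum_negf[symmetric])
    finally show "ennreal (weight (\<lambda>_. 0) s x) \<le> (\<Prod>i<d. ennreal (exp (- (x i)\<^sup>2 / (2 * (\<kappa> * s)))))"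
      by (simp add: prod_ennreal ennreal_leI)
  qed
  also have "\<dots> = (\<Prod>i<d. \<integral>\<^sup>+x. ennreal (exp (- x\<^sup>2 / (2 * (\<kappa> * s)))) \<partial>lborel)"
    by (rule product_nn_integral_prod) auto
  also have "\<dots> < \<infinity>"
    using nn_integral_exp_neg_square_finite[of "\<kappa> * s"] kappa_pos assms by (simp add: power_less_top_ennreal)
  finally show ?thesis .
qed

lemma Z_pos: "Z s > 0"
proof (rule ccontr)
  interpret product_sigma_finite "\<lambda>_::nat. lborel :: real measure" ..
  assume "\<not> Z s > 0"
  then have "(\<integral>\<^sup>+x. ennreal (weight (\<lambda>_. 0) s x) \<partial>lborel_Rd d) = 0"
    by (simp add: Z_def)
  then have "AE x in lborel_Rd d. ennreal (weight (\<lambda>_. 0) s x) = 0"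
    by (subst (asm) nn_integral_0_iff_AE) auto
  then have "AE x in lborel_Rd d. False"
    by eventually_elim (metis ennreal_eq_0_iff not_le weight_pos)
  then have "emeasure (lborel_Rd d) (space (lborel_Rd d)) = 0"
    by (simp add: AE_iff_measurable[OF sets.top])
  \<comment> \<open>This product is infinite, or 1 if \<open>d\<close> is 0, but never 0.\<close>
  moreover have "emeasure (lborel_Rd d) (Pi\<^sub>E {..<d} (\<lambda>_. UNIV)) = (\<Prod>i<d. emeasure lborel (UNIV :: real set))"
    by (intro emeasure_PiM) auto
  ultimately show False
    by (simp add: space_PiM)
qed

text \<open>The Gaussian with mean \<open>m\<close> and covariance \<open>s\<close> times the
  inverse of \<open>Q\<close>; the unknown distribution is \<open>G m 1\<close>.\<close>

definition G :: "(nat \<Rightarrow> real) \<Rightarrow> real \<Rightarrow> point measure" where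
  "G m s = density (lborel_Rd d) (\<lambda>x. ennreal (weight m s x) / Z s)"

lemma sets_G[simp, measurable_cong]: "sets (G m s) = sets (Rd d)"
  by (simp add: G_def cong: sets_PiM_cong)

lemma space_G[simp]: "space (G m s) = space (Rd d)"
  by (simp add: G_def space_PiM)

lemma nn_integral_G:
  assumes [measurable]: "f \<in> borel_measurable (Rd d)"
  shows "(\<integral>\<^sup>+x. f x \<partial>G m s) = (\<integral>\<^sup>+x. ennreal (weight m s x) * f x \<partial>lborel_Rd d) / Z s"
proof -
  have "(\<integral>\<^sup>+x. f x \<partial>G m s) = (\<integral>\<^sup>+x. ennreal (weight m s x) * f x / Z s \<partial>lborel_Rd d)"
    unfolding G_def by (subst nn_integral_density) (auto simp: divide_ennreal_def mult_ac intro!: nn_integral_cong)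
  also have "\<dots> = (\<integral>\<^sup>+x. ennreal (weight m s x) * f x \<partial>lborel_Rd d) / Z s"
    by (rule nn_integral_divide) measurable
  finally show ?thesis .
qed

lemma prob_space_G:
  assumes "s > 0"
  shows "prob_space (G m s)"
proof
  have "emeasure (G m s) (space (G m s)) = (\<integral>\<^sup>+x. 1 \<partial>G m s)"
    by simp
  also have "\<dots> = Z s / Z s"
    by (subst nn_integral_G) (auto simp: nn_integral_weight)
  also have "\<dots> = 1"
    using Z_pos[of s] Z_finite[OF assms] by (intro ennreal_divide_self) auto
  finally show "emeasure (G m s) (space (G m s)) = 1" .
qed

text \<open>
  Spares the computation of normalising constants: a functional that agrees with a Gaussian
  integral up to a constant factor agrees with it exactly.
\<close>

lemma normalization_unique:
  assumes s: "s > 0"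
    and *: "\<And>f. f \<in> borel_measurable (Rd d) \<Longrightarrow> F f = c * (\<integral>\<^sup>+x. f x \<partial>G m s)"
    and F: "F (\<lambda>_. 1) = 1" and f: "f \<in> borel_measurable (Rd d)"
  shows "F f = (\<integral>\<^sup>+x. f x \<partial>G m s)"
proof -
  interpret N: prob_space "G m s" using s by (rule prob_space_G)
  have "F (\<lambda>_. 1) = c * (\<integral>\<^sup>+x. 1 \<partial>G m s)"
    by (rule *) simp
  then have "c = 1"
    by (simp add: F N.emeasure_space_1 del: space_G)
  then show ?thesis
    using *[OF f] by simp
qed

section \<open>Scaling and sums of independent Gaussians\<close>

lemma nn_integral_G_scale:
  assumes c: "c \<noteq> 0" and s: "s > 0" and f: "f \<in> borel_measurable (Rd d)"
  shows "(\<integral>\<^sup>+x. f (\<lambda>i\<in>{..<d}. c * x i) \<partial>G m s) = (\<integral>\<^sup>+x. f x \<partial>G (\<lambda>i. c * m i) (c\<^sup>2 * s))"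
proof (rule normalization_unique[where c="(ennreal (1 / \<bar>c\<bar> ^ d) / Z s) * Z (c\<^sup>2 * s)"])
  interpret N: prob_space "G m s" using s by (rule prob_space_G)
  show "c\<^sup>2 * s > 0" "(\<integral>\<^sup>+x. 1 \<partial>G m s) = 1"
    using c s by (simp_all add: N.emeasure_space_1 del: space_G)
  \<comment> \<open>The Jacobian and both normalisers are only collected into a constant; its value
    1 follows from the total masses by \<open>normalization_unique\<close>.\<close>
  fix f :: "point \<Rightarrow> ennreal"
  assume f[measurable]: "f \<in> borel_measurable (Rd d)"
  have "(\<integral>\<^sup>+x. f (\<lambda>i\<in>{..<d}. c * x i) \<partial>G m s)
      = (\<integral>\<^sup>+x. ennreal (weight m s x) * f (\<lambda>i\<in>{..<d}. c * x i) \<partial>lborel_Rd d) / Z s"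
    by (rule nn_integral_G) measurable
  also have "(\<integral>\<^sup>+x. ennreal (weight m s x) * f (\<lambda>i\<in>{..<d}. c * x i) \<partial>lborel_Rd d)
     = ennreal (\<bar>1 / c\<bar> ^ d) * (\<integral>\<^sup>+x. ennreal (weight m s (\<lambda>i\<in>{..<d}. 0 + (1 / c) * x i)) * f (\<lambda>i\<in>{..<d}. c * (\<lambda>i\<in>{..<d}. 0 + (1 / c) * x i) i) \<partial>lborel_Rd d)"
    using c by (intro nn_integral_lborel_Rd_affine) auto
  also have "(\<integral>\<^sup>+x. ennreal (weight m s (\<lambda>i\<in>{..<d}. 0 + (1 / c) * x i)) * f (\<lambda>i\<in>{..<d}. c * (\<lambda>i\<in>{..<d}. 0 + (1 / c) * x i) i) \<partial>lborel_Rd d)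
     = (\<integral>\<^sup>+x. ennreal (weight (\<lambda>i. c * m i) (c\<^sup>2 * s) x) * f x \<partial>lborel_Rd d)"
  proof (intro nn_integral_cong arg_cong2[where f="(*)"] arg_cong[where f=ennreal] arg_cong[where f=f])
    fix x assume x: "x \<in> space (lborel_Rd d)"
    show "(\<lambda>i\<in>{..<d}. c * (\<lambda>i\<in>{..<d}. 0 + (1 / c) * x i) i) = x"
      using x c by (auto simp: space_PiM PiE_iff extensional_def fun_eq_iff)
    have "weight m s (\<lambda>i\<in>{..<d}. 0 + (1 / c) * x i) = weight (\<lambda>_. 0) s (\<lambda>i. (1 / c) * (x i - c * m i))"
      using c by (intro weight_cong) (simp add: field_simps)
    also have "\<dots> = weight (\<lambda>_. 0) (c\<^sup>2 * s) (\<lambda>i. x i - c * m i)"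
      unfolding weight_def diff_0_right bil_scale_left bil_scale_right using c by (simp add: power2_eq_square)
    also have "\<dots> = weight (\<lambda>i. c * m i) (c\<^sup>2 * s) x"
      by (rule weight_cong) simp
    finally show "weight m s (\<lambda>i\<in>{..<d}. 0 + (1 / c) * x i) = weight (\<lambda>i. c * m i) (c\<^sup>2 * s) x" .
  qed
  also have "\<dots> = Z (c\<^sup>2 * s) * (\<integral>\<^sup>+x. f x \<partial>G (\<lambda>i. c * m i) (c\<^sup>2 * s))"
    using Z_pos[of "c\<^sup>2 * s"] Z_finite[of "c\<^sup>2 * s"] c s
    by (subst nn_integral_G) (auto simp: ennreal_mult_divide_eq ennreal_times_divide mult.commute[of "Z _"])
  finally show "(\<integral>\<^sup>+x. f (\<lambda>i\<in>{..<d}. c * x i) \<partial>G m s)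
      = (ennreal (1 / \<bar>c\<bar> ^ d) / Z s) * Z (c\<^sup>2 * s) * (\<integral>\<^sup>+x. f x \<partial>G (\<lambda>i. c * m i) (c\<^sup>2 * s))"
    by (simp add: divide_ennreal_def mult_ac power_one_over abs_divide power_divide del: restrict_apply)
qed (rule f)

text \<open>Completing the square in \<open>y\<close>. For independent summands, the first factor on
  the right is the weight of their sum \<open>x\<close>, the second one the weight of the summand
  \<open>y\<close> conditioned on that sum.\<close>

lemma weight_convolution:
  assumes "s > 0" "s' > 0"
  shows "weight m' s' y * weight (\<lambda>i. m i + y i) s x = weight (\<lambda>i. m i + m' i) (s + s') x *
    weight (\<lambda>i. m' i + s' / (s + s') * (x i - (m i + m' i))) (s * s' / (s + s')) y"
proof -
  define a where "a = (\<lambda>i. y i - m' i)"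
  define u where "u = (\<lambda>i. x i - (m i + m' i))"
  have w1: "weight m' s' y = weight (\<lambda>_. 0) s' a"
    and w2: "weight (\<lambda>i. m i + y i) s x = weight (\<lambda>_. 0) s (\<lambda>i. u i - a i)"
    and w3: "weight (\<lambda>i. m i + m' i) (s + s') x = weight (\<lambda>_. 0) (s + s') u"
    and w4: "weight (\<lambda>i. m' i + s' / (s + s') * (x i - (m i + m' i))) (s * s' / (s + s')) y =
       weight (\<lambda>_. 0) (s * s' / (s + s')) (\<lambda>i. a i - s' / (s + s') * u i)"
    by (intro weight_cong; simp add: a_def u_def)+
  have half_neg: "p + q = r + t \<Longrightarrow> - p / 2 + - q / 2 = - r / 2 + - t / 2" for p q r t :: real
    by argo
  have "bil a a / s' + bil (\<lambda>i. u i - a i) (\<lambda>i. u i - a i) / s = bil u u / (s + s') +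
      bil (\<lambda>i. a i - s' / (s + s') * u i) (\<lambda>i. a i - s' / (s + s') * u i) / (s * s' / (s + s'))"
  proof -
    \<comment> \<open>By bilinearity the identity involves only these three numbers, so it is an
      identity of rational functions.\<close>
    define A B C where "A = bil a a" "B = bil a u" "C = bil u u"
    have "s + s' \<noteq> 0"
      using assms by simp
    then have "A / s' + (C - 2 * B + A) / s =
        C / (s + s') + (A - 2 * (s' / (s + s')) * B + (s' / (s + s'))\<^sup>2 * C) / (s * s' / (s + s'))"
      using assms by (simp add: divide_simps power2_eq_square) (simp add: algebra_simps)
    moreover have "bil (\<lambda>i. a i - c * u i) (\<lambda>i. a i - c * u i) = A - 2 * c * B + c\<^sup>2 * C" for c
      by (simp add: bil_linear bil_commute[of u a] A_B_C_def[symmetric] algebra_simps power2_eq_square)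
    moreover have "bil (\<lambda>i. u i - a i) (\<lambda>i. u i - a i) = C - 2 * B + A"
      by (simp add: bil_linear bil_commute[of u a] A_B_C_def[symmetric])
    ultimately show ?thesis
      by (simp only: A_B_C_def[symmetric])
  qed
  then have "- (bil a a / s') / 2 + - (bil (\<lambda>i. u i - a i) (\<lambda>i. u i - a i) / s) / 2 = - (bil u u / (s + s')) / 2 +
      - (bil (\<lambda>i. a i - s' / (s + s') * u i) (\<lambda>i. a i - s' / (s + s') * u i) / (s * s' / (s + s'))) / 2"
    by (rule half_neg)
  moreover have "- x / (2 * y) = - (x / y) / 2" for x y :: real
    by simp
  ultimately have "- bil a a / (2 * s') + - bil (\<lambda>i. u i - a i) (\<lambda>i. u i - a i) / (2 * s) = - bil u u / (2 * (s + s')) +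
      - bil (\<lambda>i. a i - s' / (s + s') * u i) (\<lambda>i. a i - s' / (s + s') * u i) / (2 * (s * s' / (s + s')))"
    by (simp only:)
  then show ?thesis
    unfolding w1 w2 w3 w4 unfolding weight_def mult_exp_exp by simp
qed

text \<open>Once the integrals are exchanged, the conditional weight of \<open>y\<close> integrates
  to a constant: its mean depends on \<open>x\<close>, but \<open>nn_integral_weight\<close> does
  not see the mean.\<close>

lemma nn_integral_G_convolution:
  assumes s: "s > 0" "s' > 0" and f: "f \<in> borel_measurable (Rd d)"
  shows "(\<integral>\<^sup>+y. (\<integral>\<^sup>+x. f (\<lambda>i\<in>{..<d}. x i + y i) \<partial>G m s) \<partial>G m' s') =
    (\<integral>\<^sup>+x. f x \<partial>G (\<lambda>i. m i + m' i) (s + s'))"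
proof (rule normalization_unique[where c="Z (s * s' / (s + s')) * Z (s + s') / (Z s * Z s')"])
  interpret N: prob_space "G m s" using s by (intro prob_space_G)
  interpret N': prob_space "G m' s'" using s by (intro prob_space_G)
  show "s + s' > 0" "(\<integral>\<^sup>+y. (\<integral>\<^sup>+x. 1 \<partial>G m s) \<partial>G m' s') = 1"
    using s by (simp_all add: N.emeasure_space_1 N'.emeasure_space_1 del: space_G)
  fix f :: "point \<Rightarrow> ennreal"
  assume f[measurable]: "f \<in> borel_measurable (Rd d)"
  interpret product_sigma_finite "\<lambda>_::nat. lborel :: real measure" ..
  interpret L: finite_product_sigma_finite "\<lambda>_::nat. lborel :: real measure" "{..<d}"
    by standard simp
  interpret LL: pair_sigma_finite "lborel_Rd d" "lborel_Rd d" ..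
  let ?m = "\<lambda>i. m i + m' i"
  have inner: "(\<integral>\<^sup>+x. f (\<lambda>i\<in>{..<d}. x i + y i) \<partial>G m s) = (\<integral>\<^sup>+x. ennreal (weight (\<lambda>i. m i + y i) s x) * f x \<partial>lborel_Rd d) / Z s"
    for y
  proof -
    have "(\<integral>\<^sup>+x. ennreal (weight (\<lambda>i. m i + y i) s x) * f x \<partial>lborel_Rd d)
       = (\<integral>\<^sup>+x. ennreal (weight (\<lambda>i. m i + y i) s (\<lambda>i\<in>{..<d}. x i + y i)) * f (\<lambda>i\<in>{..<d}. x i + y i) \<partial>lborel_Rd d)"
      by (rule nn_integral_lborel_Rd_shift[symmetric]) measurable
    also have "\<dots> = (\<integral>\<^sup>+x. ennreal (weight m s x) * f (\<lambda>i\<in>{..<d}. x i + y i) \<partial>lborel_Rd d)"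
      by (intro nn_integral_cong arg_cong2[where f="(*)"] arg_cong[where f=ennreal] weight_cong) auto
    finally show ?thesis
      by (subst nn_integral_G) auto
  qed
  have "(\<integral>\<^sup>+y. (\<integral>\<^sup>+x. f (\<lambda>i\<in>{..<d}. x i + y i) \<partial>G m s) \<partial>G m' s') =
     (\<integral>\<^sup>+y. ennreal (weight m' s' y) * ((\<integral>\<^sup>+x. ennreal (weight (\<lambda>i. m i + y i) s x) * f x \<partial>lborel_Rd d) / Z s) \<partial>lborel_Rd d) / Z s'"
    unfolding inner by (rule nn_integral_G) measurable
  also have "\<dots> = (\<integral>\<^sup>+y. (\<integral>\<^sup>+x. ennreal (weight m' s' y * weight (\<lambda>i. m i + y i) s x) * f x \<partial>lborel_Rd d) / Z s \<partial>lborel_Rd d) / Z s'"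
    by (intro arg_cong2[where f="(/)"] nn_integral_cong refl)
      (simp add: divide_ennreal_def nn_integral_cmult[symmetric] ennreal_mult less_imp_le[OF weight_pos] mult_ac)
  also have "\<dots> = (\<integral>\<^sup>+y. (\<integral>\<^sup>+x. ennreal (weight m' s' y * weight (\<lambda>i. m i + y i) s x) * f x \<partial>lborel_Rd d) \<partial>lborel_Rd d) / Z s / Z s'"
    by (subst nn_integral_divide) auto
  also have "(\<integral>\<^sup>+y. (\<integral>\<^sup>+x. ennreal (weight m' s' y * weight (\<lambda>i. m i + y i) s x) * f x \<partial>lborel_Rd d) \<partial>lborel_Rd d) =
     (\<integral>\<^sup>+x. (\<integral>\<^sup>+y. ennreal (weight m' s' y * weight (\<lambda>i. m i + y i) s x) * f x \<partial>lborel_Rd d) \<partial>lborel_Rd d)"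
    by (rule LL.Fubini') measurable
  also have "\<dots> = (\<integral>\<^sup>+x. Z (s * s' / (s + s')) * (ennreal (weight ?m (s + s') x) * f x) \<partial>lborel_Rd d)"
  proof (intro nn_integral_cong)
    fix x
    have "(\<integral>\<^sup>+y. ennreal (weight m' s' y * weight (\<lambda>i. m i + y i) s x) * f x \<partial>lborel_Rd d)
      = (\<integral>\<^sup>+y. (ennreal (weight ?m (s + s') x) * f x) * ennreal (weight (\<lambda>i. m' i + s' / (s + s') * (x i - (m i + m' i))) (s * s' / (s + s')) y) \<partial>lborel_Rd d)"
      unfolding weight_convolution[OF s]
      by (intro nn_integral_cong) (simp add: ennreal_mult less_imp_le[OF weight_pos] mult_ac)
    also have "\<dots> = (ennreal (weight ?m (s + s') x) * f x) * Z (s * s' / (s + s'))"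
      by (subst nn_integral_cmult) (auto simp: nn_integral_weight)
    finally show "(\<integral>\<^sup>+y. ennreal (weight m' s' y * weight (\<lambda>i. m i + y i) s x) * f x \<partial>lborel_Rd d)
      = Z (s * s' / (s + s')) * (ennreal (weight ?m (s + s') x) * f x)"
      by (simp add: mult.commute)
  qed
  also have "\<dots> = Z (s * s' / (s + s')) * (\<integral>\<^sup>+x. ennreal (weight ?m (s + s') x) * f x \<partial>lborel_Rd d)"
    by (rule nn_integral_cmult) measurable
  also have "(\<integral>\<^sup>+x. ennreal (weight ?m (s + s') x) * f x \<partial>lborel_Rd d) = Z (s + s') * (\<integral>\<^sup>+x. f x \<partial>G ?m (s + s'))"
    using Z_pos[of "s + s'"] Z_finite[of "s + s'"] s
    by (subst nn_integral_G) (auto simp: ennreal_mult_divide_eq ennreal_times_divide mult.commute[of "Z _"])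
  finally show "(\<integral>\<^sup>+y. (\<integral>\<^sup>+x. f (\<lambda>i\<in>{..<d}. x i + y i) \<partial>G m s) \<partial>G m' s') =
      Z (s * s' / (s + s')) * Z (s + s') / (Z s * Z s') * (\<integral>\<^sup>+x. f x \<partial>G ?m (s + s'))"
    using Z_finite[OF s(1)] Z_finite[OF s(2)]
    by (simp add: divide_ennreal_def ennreal_inverse_mult mult_ac del: restrict_apply)
qed (rule f)

text \<open>Induction adds one sample at a time, hence a general index set. It starts from a
  singleton, as the empty sum would have variance 0, which \<open>G\<close> does not
  represent.\<close>

lemma nn_integral_G_linear_combination:
  assumes s: "s > 0" and J: "finite J" "J \<noteq> {}" and a: "\<And>j. j \<in> J \<Longrightarrow> a j \<noteq> 0"
    and f: "f \<in> borel_measurable (Rd d)"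
  shows "(\<integral>\<^sup>+Y. f (\<lambda>i\<in>{..<d}. \<Sum>j\<in>J. a j * Y j i) \<partial>PiM J (\<lambda>_::nat. G m s)) =
    (\<integral>\<^sup>+x. f x \<partial>G (\<lambda>i. (\<Sum>j\<in>J. a j) * m i) ((\<Sum>j\<in>J. (a j)\<^sup>2) * s))"
  using J a f
proof (induction J arbitrary: f rule: finite_ne_induct)
  interpret N: prob_space "G m s" using s by (rule prob_space_G)
  interpret P: product_prob_space "\<lambda>_::nat. G m s" ..
  case (singleton j)
  note singleton(2)[measurable]
  have "(\<integral>\<^sup>+Y. f (\<lambda>i\<in>{..<d}. a j * Y j i) \<partial>PiM {j} (\<lambda>_. G m s)) = (\<integral>\<^sup>+y. f (\<lambda>i\<in>{..<d}. a j * y i) \<partial>G m s)"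
    by (rule P.product_nn_integral_singleton) measurable
  also have "\<dots> = (\<integral>\<^sup>+x. f x \<partial>G (\<lambda>i. a j * m i) ((a j)\<^sup>2 * s))"
    using s singleton by (intro nn_integral_G_scale) auto
  finally show ?case
    by (simp del: restrict_apply)
next
  interpret N: prob_space "G m s" using s by (rule prob_space_G)
  interpret P: product_prob_space "\<lambda>_::nat. G m s" ..
  case (insert j J)
  note insert.prems(2)[measurable]
  let ?S = "\<lambda>Y. \<lambda>i\<in>{..<d}. \<Sum>k\<in>J. a k * Y k i"
  let ?h = "\<lambda>v. \<integral>\<^sup>+w. f (\<lambda>i\<in>{..<d}. w i + v i) \<partial>G (\<lambda>i. a j * m i) ((a j)\<^sup>2 * s)"
  have aj: "a j \<noteq> 0" "(\<Sum>k\<in>J. (a k)\<^sup>2) > 0"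
    using insert by (auto intro!: sum_pos)
  interpret Gj: prob_space "G (\<lambda>i. a j * m i) ((a j)\<^sup>2 * s)"
    using s aj by (intro prob_space_G) auto
  have "(\<integral>\<^sup>+Y. f (\<lambda>i\<in>{..<d}. \<Sum>k\<in>insert j J. a k * Y k i) \<partial>PiM (insert j J) (\<lambda>_. G m s)) =
    (\<integral>\<^sup>+Y. (\<integral>\<^sup>+y. f (\<lambda>i\<in>{..<d}. \<Sum>k\<in>insert j J. a k * (Y(j := y)) k i) \<partial>G m s) \<partial>PiM J (\<lambda>_. G m s))"
    using insert.hyps by (intro P.product_nn_integral_insert) measurable
  also have "\<dots> = (\<integral>\<^sup>+Y. ?h (?S Y) \<partial>PiM J (\<lambda>_. G m s))"
  proof (intro nn_integral_cong)
    fix Y assume "Y \<in> space (PiM J (\<lambda>_. G m s))"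
    have "(\<integral>\<^sup>+y. f (\<lambda>i\<in>{..<d}. \<Sum>k\<in>insert j J. a k * (Y(j := y)) k i) \<partial>G m s) =
        (\<integral>\<^sup>+y. f (\<lambda>i\<in>{..<d}. (\<lambda>i\<in>{..<d}. a j * y i) i + ?S Y i) \<partial>G m s)"
    proof (intro nn_integral_cong arg_cong[where f=f] restrict_ext)
      fix y i assume "i \<in> {..<d}"
      have "(\<Sum>k\<in>J. a k * (Y(j := y)) k i) = (\<Sum>k\<in>J. a k * Y k i)"
        using insert.hyps by (intro sum.cong) auto
      then show "(\<Sum>k\<in>insert j J. a k * (Y(j := y)) k i) = (\<lambda>i\<in>{..<d}. a j * y i) i + ?S Y i"
        using insert.hyps \<open>i \<in> {..<d}\<close> by simp
    qed
    also have "\<dots> = (\<integral>\<^sup>+w. f (\<lambda>i\<in>{..<d}. w i + ?S Y i) \<partial>G (\<lambda>i. a j * m i) ((a j)\<^sup>2 * s))"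
      using s aj by (intro nn_integral_G_scale) measurable
    finally show "(\<integral>\<^sup>+y. f (\<lambda>i\<in>{..<d}. \<Sum>k\<in>insert j J. a k * (Y(j := y)) k i) \<partial>G m s) = ?h (?S Y)" .
  qed
  also have "\<dots> = (\<integral>\<^sup>+v. ?h v \<partial>G (\<lambda>i. (\<Sum>j\<in>J. a j) * m i) ((\<Sum>j\<in>J. (a j)\<^sup>2) * s))"
    using insert.prems by (intro insert.IH) measurable
  also have "\<dots> = (\<integral>\<^sup>+x. f x \<partial>G (\<lambda>i. a j * m i + (\<Sum>j\<in>J. a j) * m i) ((a j)\<^sup>2 * s + (\<Sum>j\<in>J. (a j)\<^sup>2) * s))"
    using s aj by (intro nn_integral_G_convolution) auto
  finally show ?case
    using insert.hyps by (simp add: distrib_right del: restrict_apply)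
qed

text \<open>A Chernoff bound that splits the exponent into halves. On the tail event the form
  exceeds \<open>r / \<kappa>\<close>, so one half contributes the exponential factor; the other
  half is the weight of doubled covariance, and the ratio of normalisers is
  \<open>sqrt 2 ^ d\<close>.\<close>

lemma emeasure_G_tail:
  "emeasure (G m 1) {x \<in> space (Rd d). r < (\<Sum>i<d. (x i - m i)\<^sup>2)} \<le> ennreal (sqrt 2 ^ d * exp (- r / (4 * \<kappa>)))"
proof -
  let ?A = "{x \<in> space (Rd d). r < (\<Sum>i<d. (x i - m i)\<^sup>2)}"
  have A[measurable]: "?A \<in> sets (Rd d)"
    by measurable
  have "emeasure (G m 1) ?A = (\<integral>\<^sup>+x. indicator ?A x \<partial>G m 1)"
    by simp
  also have "\<dots> = (\<integral>\<^sup>+x. ennreal (weight m 1 x) * indicator ?A x \<partial>lborel_Rd d) / Z 1"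
    by (rule nn_integral_G) measurable
  also have "\<dots> \<le> (\<integral>\<^sup>+x. ennreal (exp (- r / (4 * \<kappa>))) * ennreal (weight m 2 x) \<partial>lborel_Rd d) / Z 1"
  proof (intro divide_right_mono_ennreal nn_integral_mono)
    fix x
    have "weight m 1 x \<le> exp (- r / (4 * \<kappa>)) * weight m 2 x" if x: "x \<in> ?A"
    proof -
      have "r \<le> \<kappa> * bil (\<lambda>i. x i - m i) (\<lambda>i. x i - m i)"
        using norm_le_bil[of "\<lambda>i. x i - m i"] x by simp
      then have "r / (4 * \<kappa>) \<le> bil (\<lambda>i. x i - m i) (\<lambda>i. x i - m i) / 4"
        using kappa_pos by (simp add: field_simps)
      then show ?thesis
        by (simp add: weight_def mult_exp_exp)
    qed
    then show "ennreal (weight m 1 x) * indicator ?A x \<le> ennreal (exp (- r / (4 * \<kappa>))) * ennreal (weight m 2 x)"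
      by (auto simp: indicator_def ennreal_mult'[symmetric] less_imp_le[OF weight_pos] intro!: ennreal_leI)
  qed
  also have "\<dots> = ennreal (exp (- r / (4 * \<kappa>))) * Z 2 / Z 1"
    by (subst nn_integral_cmult) (auto simp: nn_integral_weight)
  also have "Z 2 = ennreal (sqrt 2 ^ d) * Z 1"
    using Z_scale[of "sqrt 2" 1] by simp
  also have "ennreal (exp (- r / (4 * \<kappa>))) * (ennreal (sqrt 2 ^ d) * Z 1) / Z 1 = ennreal (sqrt 2 ^ d * exp (- r / (4 * \<kappa>)))"
    using Z_pos[of 1] Z_finite[of 1]
    by (subst mult.assoc[symmetric], subst ennreal_mult_divide_eq) (auto simp: ennreal_mult[symmetric] mult.commute)
  finally show ?thesis .
qed

section \<open>Change of measure under translation\<close>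

definition likelihood_ratio :: "(nat \<Rightarrow> real) \<Rightarrow> point \<Rightarrow> point \<Rightarrow> real" where
  "likelihood_ratio m z x = exp (bil z (\<lambda>i. x i - m i) - bil z z / 2)"

lemma borel_measurable_likelihood_ratio[measurable]:
  assumes "\<And>i. i < d \<Longrightarrow> (\<lambda>x. f x i) \<in> borel_measurable M" "\<And>i. i < d \<Longrightarrow> (\<lambda>x. g x i) \<in> borel_measurable M"
  shows "(\<lambda>x. likelihood_ratio m (f x) (g x)) \<in> borel_measurable M"
  unfolding likelihood_ratio_def
  by (intro measurable_compose[OF _ borel_measurable_exp] borel_measurable_divide borel_measurable_bil
      borel_measurable_const borel_measurable_diff assms) auto

text \<open>The Cameron-Martin formula: \<open>likelihood_ratio m z\<close> is the density of the
  law translated by \<open>z\<close> with respect to the original one.\<close>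

lemma nn_integral_G_shift:
  assumes f[measurable]: "f \<in> borel_measurable (Rd d)"
  shows "(\<integral>\<^sup>+x. f (\<lambda>i\<in>{..<d}. x i + z i) \<partial>G m 1) = (\<integral>\<^sup>+x. ennreal (likelihood_ratio m z x) * f x \<partial>G m 1)"
proof -
  let ?w = "\<lambda>x. ennreal (weight m 1 x) * (ennreal (likelihood_ratio m z x) * f x)"
  have eq: "weight m 1 x = weight m 1 (\<lambda>i\<in>{..<d}. x i + z i) * likelihood_ratio m z (\<lambda>i\<in>{..<d}. x i + z i)" for x
  proof -
    let ?x = "\<lambda>i\<in>{..<d}. x i + z i"
    have "bil (\<lambda>i. ?x i - m i) (\<lambda>i. ?x i - m i) = bil (\<lambda>i. (x i - m i) + z i) (\<lambda>i. (x i - m i) + z i)"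
      "bil z (\<lambda>i. ?x i - m i) = bil z (\<lambda>i. (x i - m i) + z i)"
      by (intro bil_cong; simp)+
    then have "bil (\<lambda>i. ?x i - m i) (\<lambda>i. ?x i - m i) = bil (\<lambda>i. x i - m i) (\<lambda>i. x i - m i) + 2 * bil z (\<lambda>i. x i - m i) + bil z z"
      "bil z (\<lambda>i. ?x i - m i) = bil z (\<lambda>i. x i - m i) + bil z z"
      by (simp_all only: bil_add_left bil_add_right bil_commute[of "\<lambda>i. x i - m i" z])
    then show ?thesis
      unfolding weight_def likelihood_ratio_def mult_exp_exp by (simp add: diff_divide_distrib del: restrict_apply)
  qed
  have "(\<integral>\<^sup>+x. f (\<lambda>i\<in>{..<d}. x i + z i) \<partial>G m 1) = (\<integral>\<^sup>+x. ennreal (weight m 1 x) * f (\<lambda>i\<in>{..<d}. x i + z i) \<partial>lborel_Rd d) / Z 1"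
    by (rule nn_integral_G) measurable
  also have "(\<integral>\<^sup>+x. ennreal (weight m 1 x) * f (\<lambda>i\<in>{..<d}. x i + z i) \<partial>lborel_Rd d) = (\<integral>\<^sup>+x. ?w (\<lambda>i\<in>{..<d}. x i + z i) \<partial>lborel_Rd d)"
    by (subst eq) (simp add: ennreal_mult less_imp_le[OF weight_pos] likelihood_ratio_def mult.assoc del: restrict_apply)
  also have "\<dots> = (\<integral>\<^sup>+x. ?w x \<partial>lborel_Rd d)"
    by (rule nn_integral_lborel_Rd_shift) measurable
  also have "(\<integral>\<^sup>+x. ?w x \<partial>lborel_Rd d) / Z 1 = (\<integral>\<^sup>+x. ennreal (likelihood_ratio m z x) * f x \<partial>G m 1)"
    by (rule nn_integral_G[symmetric]) measurable
  finally show ?thesis .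
qed

lemma nn_integral_likelihood_ratio: "(\<integral>\<^sup>+x. ennreal (likelihood_ratio m z x) \<partial>G m 1) = 1"
proof -
  interpret N: prob_space "G m 1" by (rule prob_space_G) simp
  show ?thesis
    using nn_integral_G_shift[of "\<lambda>_. 1" m z] by (simp add: N.emeasure_space_1 del: space_G)
qed

text \<open>The product of two ratios is the ratio for \<open>z + z'\<close>, which has integral 1,
  times \<open>exp (bil z z')\<close>. The mean drops out here, so the later divergence bound is
  uniform in it.\<close>

lemma nn_integral_likelihood_ratio_mult:
  "(\<integral>\<^sup>+x. ennreal (likelihood_ratio m z x) * ennreal (likelihood_ratio m z' x) \<partial>G m 1) = ennreal (exp (bil z z'))"
proof -
  have "likelihood_ratio m z x * likelihood_ratio m z' x = exp (bil z z') * likelihood_ratio m (\<lambda>i. z i + z' i) x" for x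
    by (simp add: likelihood_ratio_def mult_exp_exp bil_add_left bil_add_right bil_commute[of z' z] field_simps)
  then have "(\<integral>\<^sup>+x. ennreal (likelihood_ratio m z x) * ennreal (likelihood_ratio m z' x) \<partial>G m 1) =
      (\<integral>\<^sup>+x. ennreal (exp (bil z z')) * ennreal (likelihood_ratio m (\<lambda>i. z i + z' i) x) \<partial>G m 1)"
    by (simp add: ennreal_mult[symmetric] likelihood_ratio_def)
  also have "\<dots> = ennreal (exp (bil z z'))"
    by (subst nn_integral_cmult) (auto simp: nn_integral_likelihood_ratio)
  finally show ?thesis .
qed

end

section \<open>Privacy of spherical Gaussian noise\<close>

text \<open>Given by coordinates instead of as an instance of \<open>G\<close>, because its
  integrals then factor; \<sigma> is the standard deviation.\<close>

definition noise :: "nat \<Rightarrow> real \<Rightarrow> (nat \<Rightarrow> real) \<Rightarrow> point measure" where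
  "noise d \<sigma> u = density (lborel_Rd d) (\<lambda>x. ennreal (\<Prod>i<d. normal_density (u i) \<sigma> (x i)))"

lemma sets_noise[simp, measurable_cong]: "sets (noise d \<sigma> u) = sets (Rd d)"
  by (simp add: noise_def cong: sets_PiM_cong)

lemma space_noise[simp]: "space (noise d \<sigma> u) = space (Rd d)"
  by (simp add: noise_def space_PiM)

lemma nn_integral_noise:
  assumes [measurable]: "f \<in> borel_measurable (Rd d)"
  shows "(\<integral>\<^sup>+x. f x \<partial>noise d \<sigma> u) = (\<integral>\<^sup>+x. ennreal (\<Prod>i<d. normal_density (u i) \<sigma> (x i)) * f x \<partial>lborel_Rd d)"
  unfolding noise_def by (rule nn_integral_density) measurable

lemma nn_integral_noise_prod:
  assumes [measurable]: "\<And>i. i < d \<Longrightarrow> g i \<in> borel_measurable borel"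
  shows "(\<integral>\<^sup>+x. (\<Prod>i<d. g i (x i)) \<partial>noise d \<sigma> u) =
    (\<Prod>i<d. \<integral>\<^sup>+x. ennreal (normal_density (u i) \<sigma> x) * g i x \<partial>lborel)"
proof -
  interpret product_sigma_finite "\<lambda>_::nat. lborel :: real measure" ..
  have "(\<integral>\<^sup>+x. (\<Prod>i<d. g i (x i)) \<partial>noise d \<sigma> u) =
     (\<integral>\<^sup>+x. ennreal (\<Prod>i<d. normal_density (u i) \<sigma> (x i)) * (\<Prod>i<d. g i (x i)) \<partial>lborel_Rd d)"
    by (rule nn_integral_noise) measurable
  also have "\<dots> = (\<integral>\<^sup>+x. (\<Prod>i<d. ennreal (normal_density (u i) \<sigma> (x i)) * g i (x i)) \<partial>lborel_Rd d)"
    by (simp add: prod.distrib prod_ennreal)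
  also have "\<dots> = (\<Prod>i<d. \<integral>\<^sup>+x. ennreal (normal_density (u i) \<sigma> x) * g i x \<partial>lborel)"
    by (rule product_nn_integral_prod) auto
  finally show ?thesis .
qed

lemma nn_integral_normal_density:
  assumes "\<sigma> > 0"
  shows "(\<integral>\<^sup>+x. ennreal (normal_density m \<sigma> x) \<partial>lborel) = 1"
  using assms by (subst nn_integral_eq_integral) auto

lemma prob_space_noise:
  assumes "\<sigma> > 0"
  shows "prob_space (noise d \<sigma> u)"
proof
  have "emeasure (noise d \<sigma> u) (space (noise d \<sigma> u)) = (\<integral>\<^sup>+x. (\<Prod>i<d. 1) \<partial>noise d \<sigma> u)"
    by simp
  also have "\<dots> = 1"
    using assms by (subst nn_integral_noise_prod) (auto simp: nn_integral_normal_density)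
  finally show "emeasure (noise d \<sigma> u) (space (noise d \<sigma> u)) = 1" .
qed

lemma nn_integral_noise_shift:
  assumes f[measurable]: "f \<in> borel_measurable (Rd d)"
  shows "(\<integral>\<^sup>+x. f x \<partial>noise d \<sigma> u) = (\<integral>\<^sup>+z. f (\<lambda>i\<in>{..<d}. z i + u i) \<partial>noise d \<sigma> (\<lambda>_. 0))"
proof -
  let ?p = "\<lambda>u x. ennreal (\<Prod>i<d. normal_density (u i) \<sigma> (x i))"
  have "(\<integral>\<^sup>+x. f x \<partial>noise d \<sigma> u) = (\<integral>\<^sup>+x. ?p u x * f x \<partial>lborel_Rd d)"
    by (rule nn_integral_noise) measurable
  also have "\<dots> = (\<integral>\<^sup>+x. ?p u (\<lambda>i\<in>{..<d}. x i + u i) * f (\<lambda>i\<in>{..<d}. x i + u i) \<partial>lborel_Rd d)"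
    by (rule nn_integral_lborel_Rd_shift[symmetric]) measurable
  also have "\<dots> = (\<integral>\<^sup>+x. ?p (\<lambda>_. 0) x * f (\<lambda>i\<in>{..<d}. x i + u i) \<partial>lborel_Rd d)"
    by (intro nn_integral_cong arg_cong2[where f="(*)"] arg_cong[where f=ennreal] prod.cong refl)
      (simp add: normal_density_def)
  also have "\<dots> = (\<integral>\<^sup>+z. f (\<lambda>i\<in>{..<d}. z i + u i) \<partial>noise d \<sigma> (\<lambda>_. 0))"
    by (rule nn_integral_noise[symmetric]) measurable
  finally show ?thesis .
qed

lemma emeasure_noise_shift:
  assumes [measurable]: "S \<in> sets (Rd d)"
  shows "emeasure (noise d \<sigma> u) S = (\<integral>\<^sup>+z. indicator S (\<lambda>i\<in>{..<d}. z i + u i) \<partial>noise d \<sigma> (\<lambda>_. 0))"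
proof -
  have "emeasure (noise d \<sigma> u) S = (\<integral>\<^sup>+x. indicator S x \<partial>noise d \<sigma> u)"
    by simp
  also have "\<dots> = (\<integral>\<^sup>+z. indicator S (\<lambda>i\<in>{..<d}. z i + u i) \<partial>noise d \<sigma> (\<lambda>_. 0))"
    by (rule nn_integral_noise_shift) measurable
  finally show ?thesis .
qed

text \<open>As a push-forward of one fixed measure, the noise depends on its centre only through a
  translation; this makes it a Markov kernel in the centre.\<close>

lemma noise_eq_distr: "noise d \<sigma> u = distr (noise d \<sigma> (\<lambda>_. 0)) (Rd d) (\<lambda>z. \<lambda>i\<in>{..<d}. z i + u i)"
proof (rule measure_eqI)
  fix S assume "S \<in> sets (noise d \<sigma> u)"
  then have S[measurable]: "S \<in> sets (Rd d)"
    by simp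
  have [measurable]: "(\<lambda>z. \<lambda>i\<in>{..<d}. z i + u i) \<in> noise d \<sigma> (\<lambda>_. 0) \<rightarrow>\<^sub>M Rd d"
    by measurable
  have "emeasure (distr (noise d \<sigma> (\<lambda>_. 0)) (Rd d) (\<lambda>z. \<lambda>i\<in>{..<d}. z i + u i)) S =
      (\<integral>\<^sup>+x. indicator S x \<partial>distr (noise d \<sigma> (\<lambda>_. 0)) (Rd d) (\<lambda>z. \<lambda>i\<in>{..<d}. z i + u i))"
    by simp
  also have "\<dots> = (\<integral>\<^sup>+z. indicator S (\<lambda>i\<in>{..<d}. z i + u i) \<partial>noise d \<sigma> (\<lambda>_. 0))"
    by (rule nn_integral_distr) measurable
  finally show "emeasure (noise d \<sigma> u) S = emeasure (distr (noise d \<sigma> (\<lambda>_. 0)) (Rd d) (\<lambda>z. \<lambda>i\<in>{..<d}. z i + u i)) S"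
    by (simp add: emeasure_noise_shift del: restrict_apply)
qed simp

lemma measurable_noise:
  assumes \<sigma>: "\<sigma> > 0" and f: "\<And>i. i < d \<Longrightarrow> (\<lambda>Y. f Y i) \<in> borel_measurable M"
  shows "(\<lambda>Y. noise d \<sigma> (f Y)) \<in> M \<rightarrow>\<^sub>M prob_algebra (Rd d)"
proof -
  note f[measurable]
  have "noise d \<sigma> (\<lambda>_. 0) \<in> space (prob_algebra (Rd d))"
    using \<sigma> by (simp add: space_prob_algebra prob_space_noise)
  then have "(\<lambda>Y. distr (noise d \<sigma> (\<lambda>_. 0)) (Rd d) (\<lambda>z. \<lambda>i\<in>{..<d}. z i + f Y i)) \<in> M \<rightarrow>\<^sub>M prob_algebra (Rd d)"
    by (intro measurable_distr_prob_space2[where M="Rd d"] measurable_const) measurable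
  then show ?thesis
    by (simp add: noise_eq_distr[symmetric])
qed

section \<open>Exponential integrals of the noise\<close>

lemma normal_density_exp_linear:
  assumes "\<sigma> > 0"
  shows "normal_density 0 \<sigma> x * exp (c * x) = exp (\<sigma>\<^sup>2 * c\<^sup>2 / 2) * normal_density (\<sigma>\<^sup>2 * c) \<sigma> x"
proof -
  have "- x\<^sup>2 / (2 * \<sigma>\<^sup>2) + c * x = \<sigma>\<^sup>2 * c\<^sup>2 / 2 + - (x - \<sigma>\<^sup>2 * c)\<^sup>2 / (2 * \<sigma>\<^sup>2)"
    using assms by (simp add: field_simps power2_eq_square)
  then show ?thesis
    by (simp add: normal_density_def mult_exp_exp)
qed

lemma nn_integral_noise_exp_linear:
  assumes \<sigma>: "\<sigma> > 0"
  shows "(\<integral>\<^sup>+z. ennreal (exp (\<Sum>i<d. c i * z i)) \<partial>noise d \<sigma> (\<lambda>_. 0)) = ennreal (exp (\<sigma>\<^sup>2 / 2 * (\<Sum>i<d. (c i)\<^sup>2)))"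
proof -
  have "(\<integral>\<^sup>+z. ennreal (exp (\<Sum>i<d. c i * z i)) \<partial>noise d \<sigma> (\<lambda>_. 0)) =
     (\<integral>\<^sup>+z. (\<Prod>i<d. ennreal (exp (c i * z i))) \<partial>noise d \<sigma> (\<lambda>_. 0))"
    by (simp add: exp_sum prod_ennreal)
  also have "\<dots> = (\<Prod>i<d. \<integral>\<^sup>+x. ennreal (normal_density 0 \<sigma> x) * ennreal (exp (c i * x)) \<partial>lborel)"
    by (rule nn_integral_noise_prod) measurable
  also have "\<dots> = (\<Prod>i<d. ennreal (exp (\<sigma>\<^sup>2 * (c i)\<^sup>2 / 2)))"
    using \<sigma> by (intro prod.cong refl)
      (simp add: ennreal_mult[symmetric] normal_density_exp_linear,
       simp add: ennreal_mult nn_integral_cmult nn_integral_normal_density)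
  also have "\<dots> = ennreal (exp (\<sigma>\<^sup>2 / 2 * (\<Sum>i<d. (c i)\<^sup>2)))"
    by (simp add: prod_ennreal exp_sum[symmetric] sum_distrib_left)
  finally show ?thesis .
qed

text \<open>The coefficient \<open>\<sigma>\<^sup>2 / 2\<close> is what integrating out one of two
  independent noise vectors leaves behind. It lowers the precision from 1/\<sigma>^2 to (1 -
  \<sigma>^4)/\<sigma>^2, which stays positive for \<sigma> below 1.\<close>

lemma normal_density_exp_square:
  assumes \<sigma>: "\<sigma> > 0" "\<sigma> < 1"
  shows "normal_density 0 \<sigma> x * exp (\<sigma>\<^sup>2 / 2 * x\<^sup>2) = 1 / sqrt (1 - \<sigma> ^ 4) * normal_density 0 (\<sigma> / sqrt (1 - \<sigma> ^ 4)) x"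
proof -
  have pos: "1 - \<sigma> ^ 4 > 0"
    using \<sigma> power_less_one_iff[of \<sigma> 4] by simp
  have "- x\<^sup>2 / (2 * \<sigma>\<^sup>2) + \<sigma>\<^sup>2 / 2 * x\<^sup>2 = - x\<^sup>2 * (1 - \<sigma> ^ 4) / (2 * \<sigma>\<^sup>2)"
    using \<sigma> by (simp add: field_simps power2_eq_square power4_eq_xxxx)
  moreover have "(\<sigma> / sqrt (1 - \<sigma> ^ 4))\<^sup>2 = \<sigma>\<^sup>2 / (1 - \<sigma> ^ 4)"
    using pos by (simp add: power_divide)
  ultimately show ?thesis
    using \<sigma> pos by (simp add: normal_density_def mult_exp_exp real_sqrt_divide real_sqrt_mult)
qed

lemma nn_integral_noise_exp_square:
  assumes \<sigma>: "\<sigma> > 0" "\<sigma> < 1"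
  shows "(\<integral>\<^sup>+z. ennreal (exp (\<sigma>\<^sup>2 / 2 * (\<Sum>i<d. (z i)\<^sup>2))) \<partial>noise d \<sigma> (\<lambda>_. 0)) = ennreal ((1 / sqrt (1 - \<sigma> ^ 4)) ^ d)"
proof -
  have pos: "1 - \<sigma> ^ 4 > 0"
    using \<sigma> power_less_one_iff[of \<sigma> 4] by simp
  have "(\<integral>\<^sup>+z. ennreal (exp (\<sigma>\<^sup>2 / 2 * (\<Sum>i<d. (z i)\<^sup>2))) \<partial>noise d \<sigma> (\<lambda>_. 0)) =
     (\<integral>\<^sup>+z. (\<Prod>i<d. ennreal (exp (\<sigma>\<^sup>2 / 2 * (z i)\<^sup>2))) \<partial>noise d \<sigma> (\<lambda>_. 0))"
    by (simp add: exp_sum[symmetric] prod_ennreal sum_distrib_left)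
  also have "\<dots> = (\<Prod>i<d. \<integral>\<^sup>+x. ennreal (normal_density 0 \<sigma> x) * ennreal (exp (\<sigma>\<^sup>2 / 2 * x\<^sup>2)) \<partial>lborel)"
    by (rule nn_integral_noise_prod) measurable
  also have "(\<integral>\<^sup>+x. ennreal (normal_density 0 \<sigma> x) * ennreal (exp (\<sigma>\<^sup>2 / 2 * x\<^sup>2)) \<partial>lborel) = ennreal (1 / sqrt (1 - \<sigma> ^ 4))"
  proof -
    have "(\<integral>\<^sup>+x. ennreal (normal_density 0 \<sigma> x) * ennreal (exp (\<sigma>\<^sup>2 / 2 * x\<^sup>2)) \<partial>lborel) =
      (\<integral>\<^sup>+x. ennreal (1 / sqrt (1 - \<sigma> ^ 4)) * ennreal (normal_density 0 (\<sigma> / sqrt (1 - \<sigma> ^ 4)) x) \<partial>lborel)"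
      using pos normal_density_exp_square[OF \<sigma>] by (intro nn_integral_cong) (simp add: ennreal_mult'[symmetric])
    also have "\<dots> = ennreal (1 / sqrt (1 - \<sigma> ^ 4))"
      using pos \<sigma> by (simp add: nn_integral_cmult nn_integral_normal_density)
    finally show ?thesis .
  qed
  finally show ?thesis
    using pos by (simp add: ennreal_power)
qed

text \<open>A power of the likelihood ratio of two normal densities of equal variance is the
  exponential of an affine function, so the tilted density is again normal, with its mean on the
  line through \<open>u\<close> and \<open>v\<close>. At \<open>t = -1\<close> it is the density
  centred at \<open>v\<close>; for \<open>t \<ge> 0\<close> the factor is a moment of the privacy
  loss.\<close>

lemma normal_density_tilt:
  assumes "\<sigma> > 0"
  shows "normal_density u \<sigma> x * exp (t * (((x - v)\<^sup>2 - (x - u)\<^sup>2) / (2 * \<sigma>\<^sup>2))) =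
    exp (t * (t + 1) * ((u - v)\<^sup>2 / (2 * \<sigma>\<^sup>2))) * normal_density ((1 + t) * u - t * v) \<sigma> x"
proof -
  have "- (x - u)\<^sup>2 + t * ((x - v)\<^sup>2 - (x - u)\<^sup>2) = t * (t + 1) * (u - v)\<^sup>2 + - (x - ((1 + t) * u - t * v))\<^sup>2"
    by (simp add: power2_eq_square algebra_simps)
  then have "(- (x - u)\<^sup>2 + t * ((x - v)\<^sup>2 - (x - u)\<^sup>2)) / (2 * \<sigma>\<^sup>2) =
      (t * (t + 1) * (u - v)\<^sup>2 + - (x - ((1 + t) * u - t * v))\<^sup>2) / (2 * \<sigma>\<^sup>2)"
    by simp
  then have "- (x - u)\<^sup>2 / (2 * \<sigma>\<^sup>2) + t * (((x - v)\<^sup>2 - (x - u)\<^sup>2) / (2 * \<sigma>\<^sup>2)) =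
      t * (t + 1) * ((u - v)\<^sup>2 / (2 * \<sigma>\<^sup>2)) + - (x - ((1 + t) * u - t * v))\<^sup>2 / (2 * \<sigma>\<^sup>2)"
    by (simp only: add_divide_distrib times_divide_eq_right)
  then show ?thesis
    by (simp only: normal_density_def mult.assoc mult.left_commute[of "exp (t * _)"] mult_exp_exp)
qed

text \<open>
  Where the log-likelihood ratio \<open>L\<close> exceeds \<open>\<epsilon>\<close>, the density is at most \<open>exp (t (L - \<epsilon>))\<close> times
  itself (a Chernoff bound under the integral).
\<close>

lemma emeasure_noise_le:
  assumes \<sigma>: "\<sigma> > 0" and t: "t \<ge> 0" and S[measurable]: "S \<in> sets (Rd d)"
  shows "emeasure (noise d \<sigma> u) S \<le> ennreal (exp \<epsilon>) * emeasure (noise d \<sigma> v) S +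
    ennreal (exp (t * (t + 1) * ((\<Sum>i<d. (u i - v i)\<^sup>2) / (2 * \<sigma>\<^sup>2)) - t * \<epsilon>))"
proof -
  let ?p = "\<lambda>u x. \<Prod>i<d. normal_density (u i) \<sigma> (x i)"
  let ?w = "\<lambda>i. (1 + t) * u i - t * v i"
  let ?K = "exp (t * (t + 1) * ((\<Sum>i<d. (u i - v i)\<^sup>2) / (2 * \<sigma>\<^sup>2)) - t * \<epsilon>)"
  have tilt: "?p u x * exp (s * (\<Sum>i<d. ((x i - v i)\<^sup>2 - (x i - u i)\<^sup>2) / (2 * \<sigma>\<^sup>2))) =
      exp (s * (s + 1) * ((\<Sum>i<d. (u i - v i)\<^sup>2) / (2 * \<sigma>\<^sup>2))) * ?p (\<lambda>i. (1 + s) * u i - s * v i) x" for s x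
  proof -
    have "?p u x * exp (s * (\<Sum>i<d. ((x i - v i)\<^sup>2 - (x i - u i)\<^sup>2) / (2 * \<sigma>\<^sup>2))) =
        (\<Prod>i<d. normal_density (u i) \<sigma> (x i) * exp (s * (((x i - v i)\<^sup>2 - (x i - u i)\<^sup>2) / (2 * \<sigma>\<^sup>2))))"
      by (simp only: sum_distrib_left exp_sum[OF finite_lessThan] prod.distrib)
    also have "\<dots> = (\<Prod>i<d. exp (s * (s + 1) * ((u i - v i)\<^sup>2 / (2 * \<sigma>\<^sup>2))) * normal_density ((1 + s) * u i - s * v i) \<sigma> (x i))"
      by (simp only: normal_density_tilt[OF \<sigma>])
    also have "\<dots> = exp (s * (s + 1) * ((\<Sum>i<d. (u i - v i)\<^sup>2) / (2 * \<sigma>\<^sup>2))) * ?p (\<lambda>i. (1 + s) * u i - s * v i) x"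
      by (simp only: sum_distrib_left sum_divide_distrib exp_sum[OF finite_lessThan] prod.distrib)
    finally show ?thesis .
  qed
  have pt: "?p u x \<le> exp \<epsilon> * ?p v x + ?K * ?p ?w x" for x
  proof -
    define L where "L = (\<Sum>i<d. ((x i - v i)\<^sup>2 - (x i - u i)\<^sup>2) / (2 * \<sigma>\<^sup>2))"
    have nn: "?p z x \<ge> 0" for z
      by (intro prod_nonneg) simp
    have v: "?p u x * exp (- L) = ?p v x"
      using tilt[of x "-1"] by (simp add: L_def)
    have w: "?p u x * exp (t * L - t * \<epsilon>) = ?K * ?p ?w x"
      using tilt[of x t] by (simp add: L_def exp_diff)
    show ?thesis
    proof (cases "L \<le> \<epsilon>")
      case True
      have "?p u x * 1 \<le> ?p u x * exp (\<epsilon> - L)"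
        using True nn by (intro mult_left_mono) auto
      also have "\<dots> = exp \<epsilon> * ?p v x"
        by (simp add: v[symmetric] exp_diff exp_minus field_simps)
      also have "\<dots> \<le> exp \<epsilon> * ?p v x + ?K * ?p ?w x"
        using nn[of ?w] by simp
      finally show ?thesis by simp
    next
      case False
      have "?p u x * 1 \<le> ?p u x * exp (t * L - t * \<epsilon>)"
        using False nn t by (intro mult_left_mono) (auto intro: mult_left_mono)
      also have "\<dots> \<le> exp \<epsilon> * ?p v x + ?K * ?p ?w x"
        using nn[of v] by (simp add: w)
      finally show ?thesis by simp
    qed
  qed
  have em: "emeasure (noise d \<sigma> z) S = (\<integral>\<^sup>+x. ennreal (?p z x) * indicator S x \<partial>lborel_Rd d)" for z
    unfolding noise_def by (rule emeasure_density) measurable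
  \<comment> \<open>The tilted density is a probability density too, so its mass on \<open>S\<close>
    is at most 1 and only the factor \<open>?K\<close> survives as additive error.\<close>
  interpret w: prob_space "noise d \<sigma> ?w"
    using \<sigma> by (rule prob_space_noise)
  have "emeasure (noise d \<sigma> u) S \<le>
     (\<integral>\<^sup>+x. ennreal (exp \<epsilon>) * (ennreal (?p v x) * indicator S x) + ennreal ?K * (ennreal (?p ?w x) * indicator S x) \<partial>lborel_Rd d)"
    unfolding em
  proof (intro nn_integral_mono)
    fix x
    have "ennreal (?p u x) \<le> ennreal (exp \<epsilon>) * ennreal (?p v x) + ennreal ?K * ennreal (?p ?w x)"
      using pt[of x] by (simp add: ennreal_mult[symmetric] ennreal_plus[symmetric] prod_nonneg del: ennreal_plus)
    then show "ennreal (?p u x) * indicator S x \<le>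
        ennreal (exp \<epsilon>) * (ennreal (?p v x) * indicator S x) + ennreal ?K * (ennreal (?p ?w x) * indicator S x)"
      by (auto simp: indicator_def)
  qed
  also have "\<dots> = ennreal (exp \<epsilon>) * emeasure (noise d \<sigma> v) S + ennreal ?K * emeasure (noise d \<sigma> ?w) S"
    unfolding em by (simp add: nn_integral_add nn_integral_cmult)
  also have "\<dots> \<le> ennreal (exp \<epsilon>) * emeasure (noise d \<sigma> v) S + ennreal ?K * 1"
    by (intro add_left_mono mult_left_mono w.emeasure_le_1) auto
  finally show ?thesis
    by simp
qed

lemma measure_noise_le:
  assumes \<sigma>: "\<sigma> > 0" and \<epsilon>: "0 < \<epsilon>" "\<epsilon> \<le> 1" and \<delta>: "0 < \<delta>" "\<delta> \<le> 1 / 2" and S: "S \<in> sets (Rd d)"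
    and close: "(\<Sum>i<d. (u i - v i)\<^sup>2) \<le> \<sigma>\<^sup>2 * \<epsilon>\<^sup>2 / (8 * ln (1 / \<delta>))"
  shows "measure (noise d \<sigma> u) S \<le> exp \<epsilon> * measure (noise d \<sigma> v) S + \<delta>"
proof -
  define l where "l = ln (1 / \<delta>)"
  have "ln 2 \<le> l"
    unfolding l_def using \<delta> by (subst ln_le_cancel_iff) (auto simp: field_simps)
  then have l: "l \<ge> 1 / 2"
    using ln2_ge_two_thirds by simp
  define \<rho> where "\<rho> = (\<Sum>i<d. (u i - v i)\<^sup>2) / (2 * \<sigma>\<^sup>2)"
  \<comment> \<open>This choice makes \<open>t * \<epsilon>\<close> equal to \<open>4 * l\<close>,
    while the bound on \<rho> keeps the quadratic term at \<open>l + \<epsilon> / 4\<close>. As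
    \<open>l \<ge> 1 / 2\<close> and \<open>\<epsilon> \<le> 1\<close>, the difference is at most
    \<open>- l = ln \<delta>\<close>.\<close>
  define t where "t = 4 * l / \<epsilon>"
  have t: "t \<ge> 0"
    using l \<epsilon> by (simp add: t_def)
  have "\<rho> \<le> (\<sigma>\<^sup>2 * \<epsilon>\<^sup>2 / (8 * l)) / (2 * \<sigma>\<^sup>2)"
    unfolding \<rho>_def l_def using close by (intro divide_right_mono) auto
  also have "\<dots> = \<epsilon>\<^sup>2 / (16 * l)"
    using \<sigma> by simp
  finally have "t * (t + 1) * \<rho> \<le> t * (t + 1) * (\<epsilon>\<^sup>2 / (16 * l))"
    using t by (intro mult_left_mono) auto
  also have "\<dots> = l + \<epsilon> / 4"
    using l \<epsilon> by (simp add: t_def field_simps power2_eq_square)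
  finally have "t * (t + 1) * \<rho> - t * \<epsilon> \<le> l + \<epsilon> / 4 - 4 * l"
    using \<epsilon> by (simp add: t_def)
  also have "\<dots> \<le> - l"
    using l \<epsilon> by simp
  finally have "exp (t * (t + 1) * \<rho> - t * \<epsilon>) \<le> exp (- l)"
    by simp
  also have "\<dots> = \<delta>"
    using \<delta> by (simp add: l_def ln_div)
  finally have K: "exp (t * (t + 1) * \<rho> - t * \<epsilon>) \<le> \<delta>" .
  interpret u: prob_space "noise d \<sigma> u" using \<sigma> by (rule prob_space_noise)
  interpret v: prob_space "noise d \<sigma> v" using \<sigma> by (rule prob_space_noise)
  have "ennreal (measure (noise d \<sigma> u) S) \<le> ennreal (exp \<epsilon> * measure (noise d \<sigma> v) S + exp (t * (t + 1) * \<rho> - t * \<epsilon>))"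
    using emeasure_noise_le[OF \<sigma> t S, of u \<epsilon> v]
    by (simp add: u.emeasure_eq_measure v.emeasure_eq_measure \<rho>_def ennreal_mult)
  then have "measure (noise d \<sigma> u) S \<le> exp \<epsilon> * measure (noise d \<sigma> v) S + exp (t * (t + 1) * \<rho> - t * \<epsilon>)"
    by (subst (asm) ennreal_le_iff) auto
  then show ?thesis
    using K by simp
qed

section \<open>The sampler\<close>

text \<open>\<open>b\<close> bounds the squared norm. The zero function need not be extensional,
  hence need not be a point of \<open>Rd d\<close>; \<open>mechanism\<close> reads only its
  coordinates below \<open>d\<close>.\<close>

definition truncate :: "real \<Rightarrow> nat \<Rightarrow> point \<Rightarrow> point" where
  "truncate b d x = (if (\<Sum>i<d. (x i)\<^sup>2) \<le> b then x else (\<lambda>_. 0))"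

lemma sum_squares_truncate_le: "b \<ge> 0 \<Longrightarrow> (\<Sum>i<d. (truncate b d x i)\<^sup>2) \<le> b"
  by (simp add: truncate_def)

definition mechanism :: "nat \<Rightarrow> real \<Rightarrow> real \<Rightarrow> nat \<Rightarrow> (nat \<Rightarrow> real) \<Rightarrow> (nat \<Rightarrow> point) \<Rightarrow> point measure" where
  "mechanism d \<sigma> b n a Y = noise d \<sigma> (\<lambda>i. \<Sum>j<n. a j * truncate b d (Y j) i)"

lemma measurable_mechanism:
  assumes "\<sigma> > 0"
  shows "mechanism d \<sigma> b n a \<in> PiM {..<n} (\<lambda>_. Rd d) \<rightarrow>\<^sub>M prob_algebra (Rd d)"
proof -
  \<comment> \<open>Measurability is shown by coordinates, since truncated samples need not lie in
    \<open>space (Rd d)\<close>.\<close>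
  have [measurable]: "(\<lambda>Y. truncate b d (Y j) i) \<in> borel_measurable (PiM {..<n} (\<lambda>_. Rd d))" if "j < n" "i < d" for i j
  proof -
    have "(\<lambda>Y. truncate b d (Y j) i) = (\<lambda>Y. if (\<Sum>k<d. (Y j k)\<^sup>2) \<le> b then Y j i else 0)"
      by (auto simp: truncate_def)
    then show ?thesis
      using that by simp
  qed
  have "(\<lambda>Y. noise d \<sigma> (\<lambda>i. \<Sum>j<n. a j * truncate b d (Y j) i)) \<in> PiM {..<n} (\<lambda>_. Rd d) \<rightarrow>\<^sub>M prob_algebra (Rd d)"
    using assms by (intro measurable_noise) measurable
  then show ?thesis
    by (simp add: mechanism_def[abs_def])
qed

lemma sum_squares_diff_le:
  fixes x y :: "nat \<Rightarrow> real"
  assumes "(\<Sum>i<d. (x i)\<^sup>2) \<le> b" "(\<Sum>i<d. (y i)\<^sup>2) \<le> b"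
  shows "(\<Sum>i<d. (x i - y i)\<^sup>2) \<le> 4 * b"
proof -
  have "(\<Sum>i<d. (x i - y i)\<^sup>2) \<le> (\<Sum>i<d. 2 * (x i)\<^sup>2 + 2 * (y i)\<^sup>2)"
  proof (intro sum_mono)
    fix i
    have "0 \<le> (x i + y i)\<^sup>2" by simp
    then show "(x i - y i)\<^sup>2 \<le> 2 * (x i)\<^sup>2 + 2 * (y i)\<^sup>2"
      by (simp add: power2_sum power2_diff)
  qed
  also have "\<dots> \<le> 4 * b"
    using assms by (simp add: sum.distrib sum_distrib_left[symmetric])
  finally show ?thesis .
qed

text \<open>Neighbouring datasets differ in a single summand. Its coefficient has square
  \<open>1 / n\<close>, and two truncated samples are at squared distance at most
  \<open>4 * b\<close>; the condition on \<open>n\<close> makes the resulting shift admissible for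
  \<open>measure_noise_le\<close>.\<close>

lemma diff_private_mechanism:
  assumes \<sigma>: "\<sigma> > 0" and \<epsilon>: "0 < \<epsilon>" "\<epsilon> \<le> 1" and \<delta>: "0 < \<delta>" "\<delta> \<le> 1 / 2" and b: "b \<ge> 0"
    and a: "\<And>j. j < n \<Longrightarrow> (a j)\<^sup>2 = 1 / real n"
    and n: "32 * b * ln (1 / \<delta>) \<le> real n * \<sigma>\<^sup>2 * \<epsilon>\<^sup>2"
  shows "diff_private (Rd d) n \<epsilon> \<delta> (mechanism d \<sigma> b n a)"
  unfolding diff_private_def
proof (intro ballI impI)
  fix Y Y' :: "nat \<Rightarrow> point" and S
  assume nb: "neighbors n Y Y'" and S: "S \<in> sets (Rd d)"
  from nb obtain k where k: "{i \<in> {..<n}. Y i \<noteq> Y' i} = {k}"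
    unfolding neighbors_def by (auto simp: card_1_singleton_iff)
  then have kn: "k < n" and eq: "\<And>j. j < n \<Longrightarrow> j \<noteq> k \<Longrightarrow> Y j = Y' j"
    by auto
  let ?u = "\<lambda>(Y :: nat \<Rightarrow> point) i. \<Sum>j<n. a j * truncate b d (Y j) i"
  have diff: "?u Y i - ?u Y' i = a k * (truncate b d (Y k) i - truncate b d (Y' k) i)" for i
  proof -
    have "?u Y i - ?u Y' i = (\<Sum>j<n. a j * (truncate b d (Y j) i - truncate b d (Y' j) i))"
      by (simp add: sum_subtractf[symmetric] right_diff_distrib)
    also have "\<dots> = (\<Sum>j<n. if j = k then a j * (truncate b d (Y j) i - truncate b d (Y' j) i) else 0)"
      using eq by (intro sum.cong) auto
    also have "\<dots> = a k * (truncate b d (Y k) i - truncate b d (Y' k) i)"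
      using kn by simp
    finally show ?thesis .
  qed
  have l: "ln (1 / \<delta>) > 0"
    using \<delta> by (intro ln_gt_zero) (auto simp: field_simps)
  have "(\<Sum>i<d. (?u Y i - ?u Y' i)\<^sup>2) = (1 / real n) * (\<Sum>i<d. (truncate b d (Y k) i - truncate b d (Y' k) i)\<^sup>2)"
    unfolding diff by (simp add: power_mult_distrib a[OF kn] sum_divide_distrib)
  also have "\<dots> \<le> (1 / real n) * (4 * b)"
    using b by (intro mult_left_mono sum_squares_diff_le sum_squares_truncate_le) auto
  also have "\<dots> \<le> \<sigma>\<^sup>2 * \<epsilon>\<^sup>2 / (8 * ln (1 / \<delta>))"
    using n l kn by (simp only: mult_1 times_divide_eq_left) (simp add: pos_divide_le_eq pos_le_divide_eq mult_ac)
  finally show "measure (mechanism d \<sigma> b n a Y) S \<le> exp \<epsilon> * measure (mechanism d \<sigma> b n a Y') S + \<delta>"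
    unfolding mechanism_def using \<sigma> \<epsilon> \<delta> S by (intro measure_noise_le) auto
qed

section \<open>Accuracy of the noisy combination\<close>

context quadratic_form begin

text \<open>Density, with respect to \<open>G m 1\<close>, of the law of a sample plus independent
  noise. That law has covariance \<Sigma> + \<sigma>^2 I, in general no multiple of \<Sigma>, so it
  is treated as a mixture of translates and not as another \<open>G\<close>.\<close>

definition mixture_ratio :: "real \<Rightarrow> (nat \<Rightarrow> real) \<Rightarrow> point \<Rightarrow> ennreal" where
  "mixture_ratio \<sigma> m x = (\<integral>\<^sup>+z. ennreal (likelihood_ratio m z x) \<partial>noise d \<sigma> (\<lambda>_. 0))"

lemma borel_measurable_mixture_ratio[measurable]:
  assumes \<sigma>: "\<sigma> > 0"
  shows "mixture_ratio \<sigma> m \<in> borel_measurable (Rd d)"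
proof -
  interpret N: prob_space "noise d \<sigma> (\<lambda>_. 0)" using \<sigma> by (rule prob_space_noise)
  show ?thesis
    unfolding mixture_ratio_def[abs_def] by measurable
qed

text \<open>The inner integral is a moment generating function evaluated at \<open>Q\<close> applied
  to \<open>z'\<close>. There \<open>contraction\<close>, which comes from I \<preceq> \<Sigma>,
  removes \<open>Q\<close>, and the bound no longer depends on the covariance.\<close>

lemma nn_integral_noise_bil_le:
  assumes \<sigma>: "\<sigma> > 0" "\<sigma> < 1"
  shows "(\<integral>\<^sup>+z'. (\<integral>\<^sup>+z. ennreal (exp (bil z z')) \<partial>noise d \<sigma> (\<lambda>_. 0)) \<partial>noise d \<sigma> (\<lambda>_. 0)) \<le>
    ennreal ((1 / sqrt (1 - \<sigma> ^ 4)) ^ d)"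
proof -
  have "(\<integral>\<^sup>+z. ennreal (exp (bil z z')) \<partial>noise d \<sigma> (\<lambda>_. 0)) \<le> ennreal (exp (\<sigma>\<^sup>2 / 2 * (\<Sum>i<d. (z' i)\<^sup>2)))" for z'
  proof -
    have "bil z z' = (\<Sum>i<d. (\<Sum>j<d. Q i j * z' j) * z i)" for z
      by (simp add: bil_def sum_distrib_left sum_distrib_right mult_ac)
    then have "(\<integral>\<^sup>+z. ennreal (exp (bil z z')) \<partial>noise d \<sigma> (\<lambda>_. 0)) =
        ennreal (exp (\<sigma>\<^sup>2 / 2 * (\<Sum>i<d. (\<Sum>j<d. Q i j * z' j)\<^sup>2)))"
      using nn_integral_noise_exp_linear[OF \<sigma>(1), of d "\<lambda>i. \<Sum>j<d. Q i j * z' j"] by simp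
    also have "\<dots> \<le> ennreal (exp (\<sigma>\<^sup>2 / 2 * (\<Sum>i<d. (z' i)\<^sup>2)))"
      using contraction[of z'] by (intro ennreal_leI) (simp add: mult_left_mono)
    finally show ?thesis .
  qed
  then have "(\<integral>\<^sup>+z'. (\<integral>\<^sup>+z. ennreal (exp (bil z z')) \<partial>noise d \<sigma> (\<lambda>_. 0)) \<partial>noise d \<sigma> (\<lambda>_. 0)) \<le>
      (\<integral>\<^sup>+z'. ennreal (exp (\<sigma>\<^sup>2 / 2 * (\<Sum>i<d. (z' i)\<^sup>2))) \<partial>noise d \<sigma> (\<lambda>_. 0))"
    by (intro nn_integral_mono)
  then show ?thesis
    unfolding nn_integral_noise_exp_square[OF \<sigma>] .
qed

text \<open>Each identity exchanges the Gaussian integral with that over the noise. The square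
  becomes a double integral over two independent copies of the noise, after which the Gaussian can
  be integrated out in closed form.\<close>

lemma
  assumes \<sigma>: "\<sigma> > 0"
  shows nn_integral_mixture_ratio: "(\<integral>\<^sup>+x. mixture_ratio \<sigma> m x \<partial>G m 1) = 1"
    and nn_integral_mixture_ratio_square: "(\<integral>\<^sup>+x. mixture_ratio \<sigma> m x * mixture_ratio \<sigma> m x \<partial>G m 1) =
      (\<integral>\<^sup>+z'. (\<integral>\<^sup>+z. ennreal (exp (bil z z')) \<partial>noise d \<sigma> (\<lambda>_. 0)) \<partial>noise d \<sigma> (\<lambda>_. 0))"
    and nn_integral_mixture: "\<And>f. f \<in> borel_measurable (Rd d) \<Longrightarrow>
      (\<integral>\<^sup>+x. (\<integral>\<^sup>+z. f (\<lambda>i\<in>{..<d}. z i + x i) \<partial>noise d \<sigma> (\<lambda>_. 0)) \<partial>G m 1) =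
      (\<integral>\<^sup>+x. mixture_ratio \<sigma> m x * f x \<partial>G m 1)"
proof -
  let ?N = "noise d \<sigma> (\<lambda>_. 0)"
  let ?r = "\<lambda>z x. ennreal (likelihood_ratio m z x)"
  interpret N: prob_space ?N using \<sigma> by (rule prob_space_noise)
  interpret D: prob_space "G m 1" by (rule prob_space_G) simp
  interpret DN: pair_sigma_finite "G m 1" ?N ..
  have "(\<integral>\<^sup>+x. mixture_ratio \<sigma> m x \<partial>G m 1) = (\<integral>\<^sup>+z. (\<integral>\<^sup>+x. ?r z x \<partial>G m 1) \<partial>?N)"
    unfolding mixture_ratio_def by (rule DN.Fubini'[symmetric]) measurable
  also have "\<dots> = 1"
    by (simp add: nn_integral_likelihood_ratio N.emeasure_space_1 del: space_noise)
  finally show "(\<integral>\<^sup>+x. mixture_ratio \<sigma> m x \<partial>G m 1) = 1" .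
  have "(\<integral>\<^sup>+x. mixture_ratio \<sigma> m x * mixture_ratio \<sigma> m x \<partial>G m 1) =
      (\<integral>\<^sup>+x. (\<integral>\<^sup>+z'. (\<integral>\<^sup>+z. ?r z x * ?r z' x \<partial>?N) \<partial>?N) \<partial>G m 1)"
    unfolding mixture_ratio_def by (simp add: nn_integral_multc nn_integral_cmult mult.commute)
  also have "\<dots> = (\<integral>\<^sup>+z'. (\<integral>\<^sup>+x. (\<integral>\<^sup>+z. ?r z x * ?r z' x \<partial>?N) \<partial>G m 1) \<partial>?N)"
    by (rule DN.Fubini'[symmetric]) measurable
  also have "\<dots> = (\<integral>\<^sup>+z'. (\<integral>\<^sup>+z. (\<integral>\<^sup>+x. ?r z x * ?r z' x \<partial>G m 1) \<partial>?N) \<partial>?N)"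
    by (intro nn_integral_cong DN.Fubini'[symmetric]) measurable
  also have "\<dots> = (\<integral>\<^sup>+z'. (\<integral>\<^sup>+z. ennreal (exp (bil z z')) \<partial>?N) \<partial>?N)"
    unfolding nn_integral_likelihood_ratio_mult ..
  finally show "(\<integral>\<^sup>+x. mixture_ratio \<sigma> m x * mixture_ratio \<sigma> m x \<partial>G m 1) =
      (\<integral>\<^sup>+z'. (\<integral>\<^sup>+z. ennreal (exp (bil z z')) \<partial>?N) \<partial>?N)" .
  fix f :: "point \<Rightarrow> ennreal"
  assume f[measurable]: "f \<in> borel_measurable (Rd d)"
  have "(\<integral>\<^sup>+x. (\<integral>\<^sup>+z. f (\<lambda>i\<in>{..<d}. z i + x i) \<partial>?N) \<partial>G m 1) = (\<integral>\<^sup>+z. (\<integral>\<^sup>+x. f (\<lambda>i\<in>{..<d}. x i + z i) \<partial>G m 1) \<partial>?N)"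
    by (subst add.commute, rule DN.Fubini'[symmetric]) measurable
  also have "\<dots> = (\<integral>\<^sup>+z. (\<integral>\<^sup>+x. ?r z x * f x \<partial>G m 1) \<partial>?N)"
    by (intro nn_integral_cong nn_integral_G_shift) measurable
  also have "\<dots> = (\<integral>\<^sup>+x. (\<integral>\<^sup>+z. ?r z x * f x \<partial>?N) \<partial>G m 1)"
    by (rule DN.Fubini') measurable
  also have "\<dots> = (\<integral>\<^sup>+x. mixture_ratio \<sigma> m x * f x \<partial>G m 1)"
    unfolding mixture_ratio_def by (simp add: nn_integral_multc)
  finally show "(\<integral>\<^sup>+x. (\<integral>\<^sup>+z. f (\<lambda>i\<in>{..<d}. z i + x i) \<partial>?N) \<partial>G m 1) = (\<integral>\<^sup>+x. mixture_ratio \<sigma> m x * f x \<partial>G m 1)" .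
qed

text \<open>The second moment of the ratio minus 1 is the chi-square divergence, and its root bounds
  the total variation distance.\<close>

lemma abs_measure_mixture_diff_le:
  assumes \<sigma>: "\<sigma> > 0" "\<sigma> < 1" and c: "c > 0" "(1 / sqrt (1 - \<sigma> ^ 4)) ^ d \<le> 1 + c\<^sup>2"
    and S: "S \<in> sets (Rd d)"
  shows "\<bar>measure (G m 1) S - measure (density (G m 1) (mixture_ratio \<sigma> m)) S\<bar> \<le> c"
proof -
  interpret D: prob_space "G m 1" by (rule prob_space_G) simp
  have "(\<integral>\<^sup>+x. mixture_ratio \<sigma> m x * mixture_ratio \<sigma> m x \<partial>G m 1) \<le> ennreal ((1 / sqrt (1 - \<sigma> ^ 4)) ^ d)"
    unfolding nn_integral_mixture_ratio_square[OF \<sigma>(1)] by (rule nn_integral_noise_bil_le[OF \<sigma>])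
  also have "\<dots> \<le> ennreal (1 + c\<^sup>2)"
    using c by (intro ennreal_leI)
  finally show ?thesis
    using \<sigma> c S by (intro D.abs_measure_diff_density_le) (auto simp: nn_integral_mixture_ratio)
qed

text \<open>Concerns the idealised sampler without truncation: by the two conditions on the
  coefficients, the combination of samples has the law \<open>G m 1\<close> itself, so only the
  noise separates the output from the target.\<close>

lemma emeasure_mixture_eq:
  fixes n :: nat
  assumes \<sigma>: "\<sigma> > 0" and n: "n > 0" and a: "\<And>j. j < n \<Longrightarrow> a j \<noteq> 0" "(\<Sum>j<n. a j) = 1" "(\<Sum>j<n. (a j)\<^sup>2) = 1"
    and S[measurable]: "S \<in> sets (Rd d)"
  shows "(\<integral>\<^sup>+Y. emeasure (noise d \<sigma> (\<lambda>i. \<Sum>j<n. a j * Y j i)) S \<partial>PiM {..<n} (\<lambda>_. G m 1)) =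
    emeasure (density (G m 1) (mixture_ratio \<sigma> m)) S"
proof -
  let ?N = "noise d \<sigma> (\<lambda>_. 0)"
  note borel_measurable_mixture_ratio[OF \<sigma>, measurable]
  interpret N: prob_space ?N using \<sigma> by (rule prob_space_noise)
  let ?F = "\<lambda>u. \<integral>\<^sup>+z. indicator S (\<lambda>i\<in>{..<d}. z i + u i) \<partial>?N"
  have "(\<integral>\<^sup>+Y. emeasure (noise d \<sigma> (\<lambda>i. \<Sum>j<n. a j * Y j i)) S \<partial>PiM {..<n} (\<lambda>_. G m 1)) =
      (\<integral>\<^sup>+Y. ?F (\<lambda>i\<in>{..<d}. \<Sum>j<n. a j * Y j i) \<partial>PiM {..<n} (\<lambda>_. G m 1))"
    by (intro nn_integral_cong, subst emeasure_noise_shift[OF S])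
      (intro nn_integral_cong arg_cong[where f="indicator S"] restrict_ext, simp)
  also have "\<dots> = (\<integral>\<^sup>+u. ?F u \<partial>G (\<lambda>i. (\<Sum>j<n. a j) * m i) ((\<Sum>j<n. (a j)\<^sup>2) * 1))"
    using n a by (intro nn_integral_G_linear_combination[where f="?F"]) auto
  also have "\<dots> = (\<integral>\<^sup>+u. ?F u \<partial>G m 1)"
    by (simp add: a del: restrict_apply)
  also have "\<dots> = (\<integral>\<^sup>+x. mixture_ratio \<sigma> m x * indicator S x \<partial>G m 1)"
    by (rule nn_integral_mixture[OF \<sigma>]) measurable
  also have "\<dots> = emeasure (density (G m 1) (mixture_ratio \<sigma> m)) S"
    by (rule emeasure_density[symmetric]) measurable
  finally show ?thesis .
qed

text \<open>On a fixed dataset the actual and the idealised kernel coincide unless some sample is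
  truncated. Each is thus at most the other plus the indicator of that event, whose probability is
  controlled by a union bound over the samples.\<close>

lemma abs_measure_mechanism_diff_le:
  assumes \<sigma>: "\<sigma> > 0" and n: "n > 0" and a: "\<And>j. j < n \<Longrightarrow> a j \<noteq> 0" "(\<Sum>j<n. a j) = 1" "(\<Sum>j<n. (a j)\<^sup>2) = 1"
    and S[measurable]: "S \<in> sets (Rd d)"
    and tail: "real n * measure (G m 1) {x \<in> space (Rd d). b < (\<Sum>i<d. (x i)\<^sup>2)} \<le> c"
  shows "\<bar>measure (density (G m 1) (mixture_ratio \<sigma> m)) S - measure (output_dist n (mechanism d \<sigma> b n a) (G m 1)) S\<bar> \<le> c"
proof -
  let ?D = "PiM {..<n} (\<lambda>_. G m 1)"
  let ?B = "{x \<in> space (Rd d). b < (\<Sum>i<d. (x i)\<^sup>2)}"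
  interpret D: prob_space "G m 1" by (rule prob_space_G) simp
  interpret Dn: prob_space ?D by (intro prob_space_PiM D.prob_space_axioms)
  interpret P: product_prob_space "\<lambda>_::nat. G m 1" "{..<n}" ..
  let ?O = "output_dist n (mechanism d \<sigma> b n a) (G m 1)"
  let ?bad = "\<Union>j<n. {Y \<in> space ?D. Y j \<in> ?B}"
  have B[measurable]: "?B \<in> sets (Rd d)"
    by measurable
  have mech: "mechanism d \<sigma> b n a \<in> ?D \<rightarrow>\<^sub>M prob_algebra (Rd d)"
    using measurable_mechanism[OF \<sigma>] by (simp cong: measurable_cong_sets sets_PiM_cong)
  have noise: "(\<lambda>Y. noise d \<sigma> (\<lambda>i. \<Sum>j<n. a j * Y j i)) \<in> ?D \<rightarrow>\<^sub>M prob_algebra (Rd d)"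
    using \<sigma> by (intro measurable_noise) measurable
  have prob: "prob_space ?O"
    unfolding output_dist_def
    by (rule prob_space_bind'[OF _ mech]) (simp add: space_prob_algebra Dn.prob_space_axioms)
  interpret O: prob_space ?O by (rule prob)
  interpret M: prob_space "density (G m 1) (mixture_ratio \<sigma> m)"
  proof
    note borel_measurable_mixture_ratio[OF \<sigma>, measurable]
    have "emeasure (density (G m 1) (mixture_ratio \<sigma> m)) (space (G m 1)) =
        (\<integral>\<^sup>+x. mixture_ratio \<sigma> m x * indicator (space (G m 1)) x \<partial>G m 1)"
      using sets.top[of "G m 1"] by (intro emeasure_density) (auto simp del: space_G)
    also have "\<dots> = (\<integral>\<^sup>+x. mixture_ratio \<sigma> m x \<partial>G m 1)"
      by (rule nn_integral_cong) (simp del: space_G)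
    finally show "emeasure (density (G m 1) (mixture_ratio \<sigma> m)) (space (density (G m 1) (mixture_ratio \<sigma> m))) = 1"
      by (simp add: nn_integral_mixture_ratio[OF \<sigma>])
  qed
  have bad_meas[measurable]: "?bad \<in> sets ?D"
    by measurable
  have "measure ?D ?bad \<le> (\<Sum>j<n. measure ?D {Y \<in> space ?D. Y j \<in> ?B})"
    by (intro Dn.finite_measure_subadditive_finite) auto
  also have "\<dots> = (\<Sum>j<n. measure (G m 1) ?B)"
  proof (intro sum.cong refl)
    fix j assume "j \<in> {..<n}"
    then have "emeasure ?D {Y \<in> space ?D. Y j \<in> ?B} = emeasure (G m 1) ?B"
      by (intro P.emeasure_PiM_Collect_single) auto
    then show "measure ?D {Y \<in> space ?D. Y j \<in> ?B} = measure (G m 1) ?B"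
      by (simp only: measure_def)
  qed
  also have "\<dots> \<le> c"
    using tail by simp
  finally have bad: "measure ?D ?bad \<le> c" .
  have O: "emeasure ?O S = (\<integral>\<^sup>+Y. emeasure (mechanism d \<sigma> b n a Y) S \<partial>?D)"
    unfolding output_dist_def
    by (rule emeasure_bind_prob_algebra[OF _ mech S]) (simp add: space_prob_algebra Dn.prob_space_axioms)
  have M: "emeasure (density (G m 1) (mixture_ratio \<sigma> m)) S = (\<integral>\<^sup>+Y. emeasure (noise d \<sigma> (\<lambda>i. \<Sum>j<n. a j * Y j i)) S \<partial>?D)"
    by (rule emeasure_mixture_eq[OF \<sigma> n a S, symmetric])
  have mO[measurable]: "(\<lambda>Y. emeasure (mechanism d \<sigma> b n a Y) S) \<in> borel_measurable ?D"
    using measurable_compose[OF measurable_prob_algebraD[OF mech] measurable_emeasure_subprob_algebra[OF S]] .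
  have mM[measurable]: "(\<lambda>Y. emeasure (noise d \<sigma> (\<lambda>i. \<Sum>j<n. a j * Y j i)) S) \<in> borel_measurable ?D"
    using measurable_compose[OF measurable_prob_algebraD[OF noise] measurable_emeasure_subprob_algebra[OF S]] .
  have le: "emeasure (noise d \<sigma> u) S \<le> 1" for u
    using prob_space_noise[OF \<sigma>] by (intro subprob_space.subprob_emeasure_le_1 prob_space_imp_subprob_space)
  have good: "mechanism d \<sigma> b n a Y = noise d \<sigma> (\<lambda>i. \<Sum>j<n. a j * Y j i)" if "Y \<in> space ?D" "Y \<notin> ?bad" for Y
  proof -
    have "truncate b d (Y j) = Y j" if "j < n" for j
      using \<open>Y \<in> space ?D\<close> \<open>Y \<notin> ?bad\<close> that by (auto simp: truncate_def space_PiM PiE_iff not_less)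
    then show ?thesis
      unfolding mechanism_def by (intro arg_cong[where f="noise d \<sigma>"]) (auto intro!: sum.cong)
  qed
  have "emeasure ?O S \<le> (\<integral>\<^sup>+Y. emeasure (noise d \<sigma> (\<lambda>i. \<Sum>j<n. a j * Y j i)) S + indicator ?bad Y \<partial>?D)"
    unfolding O
  proof (rule nn_integral_mono)
    fix Y assume "Y \<in> space ?D"
    then show "emeasure (mechanism d \<sigma> b n a Y) S \<le> emeasure (noise d \<sigma> (\<lambda>i. \<Sum>j<n. a j * Y j i)) S + indicator ?bad Y"
      using good[of Y] le[of "\<lambda>i. \<Sum>j<n. a j * truncate b d (Y j) i"]
      by (cases "Y \<in> ?bad") (auto simp: mechanism_def intro: add_increasing simp del: UN_iff)
  qed
  also have "\<dots> = emeasure (density (G m 1) (mixture_ratio \<sigma> m)) S + emeasure ?D ?bad"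
    unfolding M by (subst nn_integral_add) auto
  finally have 1: "measure ?O S \<le> measure (density (G m 1) (mixture_ratio \<sigma> m)) S + measure ?D ?bad"
    by (simp add: O.emeasure_eq_measure M.emeasure_eq_measure Dn.emeasure_eq_measure ennreal_plus[symmetric] del: ennreal_plus UN_iff)
  have "emeasure (density (G m 1) (mixture_ratio \<sigma> m)) S \<le> (\<integral>\<^sup>+Y. emeasure (mechanism d \<sigma> b n a Y) S + indicator ?bad Y \<partial>?D)"
    unfolding M
  proof (rule nn_integral_mono)
    fix Y assume "Y \<in> space ?D"
    then show "emeasure (noise d \<sigma> (\<lambda>i. \<Sum>j<n. a j * Y j i)) S \<le> emeasure (mechanism d \<sigma> b n a Y) S + indicator ?bad Y"
      using good[of Y] le[of "\<lambda>i. \<Sum>j<n. a j * Y j i"]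
      by (cases "Y \<in> ?bad") (auto intro: add_increasing simp del: UN_iff)
  qed
  also have "\<dots> = emeasure ?O S + emeasure ?D ?bad"
    unfolding O by (subst nn_integral_add) auto
  finally have 2: "measure (density (G m 1) (mixture_ratio \<sigma> m)) S \<le> measure ?O S + measure ?D ?bad"
    by (simp add: O.emeasure_eq_measure M.emeasure_eq_measure Dn.emeasure_eq_measure ennreal_plus[symmetric] del: ennreal_plus UN_iff)
  show ?thesis
    using 1 2 bad by linarith
qed

text \<open>Truncation is centred at the origin because the mean is unknown, so the deviation bound
  has to be moved there; this costs the factors 2 on \<open>B\<close> and \<open>r\<close>.\<close>

lemma measure_G_norm_tail:
  assumes "(\<Sum>i<d. (m i)\<^sup>2) \<le> B"
  shows "measure (G m 1) {x \<in> space (Rd d). 2 * B + 2 * r < (\<Sum>i<d. (x i)\<^sup>2)} \<le> sqrt 2 ^ d * exp (- r / (4 * \<kappa>))"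
proof -
  interpret D: prob_space "G m 1" by (rule prob_space_G) simp
  let ?A = "{x \<in> space (Rd d). r < (\<Sum>i<d. (x i - m i)\<^sup>2)}"
  have "(\<Sum>i<d. (x i)\<^sup>2) \<le> 2 * (\<Sum>i<d. (m i)\<^sup>2) + 2 * (\<Sum>i<d. (x i - m i)\<^sup>2)" for x
  proof -
    have "(x i)\<^sup>2 \<le> 2 * (m i)\<^sup>2 + 2 * (x i - m i)\<^sup>2" for i
    proof -
      have "0 \<le> (x i - 2 * m i)\<^sup>2"
        by simp
      then show ?thesis
        by (simp add: power2_eq_square algebra_simps)
    qed
    then show ?thesis
      by (simp add: sum_distrib_left sum.distrib[symmetric] sum_mono)
  qed
  then have "{x \<in> space (Rd d). 2 * B + 2 * r < (\<Sum>i<d. (x i)\<^sup>2)} \<subseteq> ?A"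
    using assms by (fastforce dest: less_le_trans)
  then have "measure (G m 1) {x \<in> space (Rd d). 2 * B + 2 * r < (\<Sum>i<d. (x i)\<^sup>2)} \<le> measure (G m 1) ?A"
    by (intro D.finite_measure_mono) auto
  also have "\<dots> \<le> sqrt 2 ^ d * exp (- r / (4 * \<kappa>))"
    using emeasure_G_tail[of m r] by (simp add: D.emeasure_eq_measure)
  finally show ?thesis .
qed

text \<open>Triangle inequality through the idealised law: one \<open>c\<close> pays for the noise,
  the other for truncation.\<close>

lemma tv_dist_mechanism_le:
  assumes \<sigma>: "\<sigma> > 0" "\<sigma> < 1" and c: "c > 0" "(1 / sqrt (1 - \<sigma> ^ 4)) ^ d \<le> 1 + c\<^sup>2"
    and n: "n > 0" and a: "\<And>j. j < n \<Longrightarrow> a j \<noteq> 0" "(\<Sum>j<n. a j) = 1" "(\<Sum>j<n. (a j)\<^sup>2) = 1"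
    and B: "(\<Sum>i<d. (m i)\<^sup>2) \<le> B" and r: "real n * (sqrt 2 ^ d * exp (- r / (4 * \<kappa>))) \<le> c"
  shows "tv_dist (G m 1) (output_dist n (mechanism d \<sigma> (2 * B + 2 * r) n a) (G m 1)) \<le> 2 * c"
  unfolding tv_dist_def
proof (rule cSUP_least)
  fix S assume "S \<in> sets (G m 1)"
  then have S: "S \<in> sets (Rd d)"
    by simp
  have "real n * measure (G m 1) {x \<in> space (Rd d). 2 * B + 2 * r < (\<Sum>i<d. (x i)\<^sup>2)} \<le> c"
    using mult_left_mono[OF measure_G_norm_tail[OF B, of r], of "real n"] r by linarith
  from abs_measure_mechanism_diff_le[OF \<sigma>(1) n a S this] abs_measure_mixture_diff_le[OF \<sigma> c S, of m]
  show "\<bar>measure (G m 1) S - measure (output_dist n (mechanism d \<sigma> (2 * B + 2 * r) n a) (G m 1)) S\<bar> \<le> 2 * c"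
    by linarith
qed (use sets.top in blast)

end

section \<open>The inverse covariance matrix\<close>

lemma scalar_prod_mult_mat_vec_eq_sum:
  assumes "A \<in> carrier_mat d d"
  shows "scalar_prod (Matrix.vec d x) (A *\<^sub>v Matrix.vec d y) = (\<Sum>i<d. \<Sum>j<d. x i * A $$ (i, j) * y j :: real)"
  using assms by (simp add: scalar_prod_def sum_distrib_left mult.assoc lessThan_atLeast0)

text \<open>Here \<open>y\<close> is the inverse of \<open>S\<close> applied to \<open>x\<close>, so
  the conclusions are what \<open>quadratic_form\<close> demands of that inverse. The first one
  holds since \<open>lower\<close> at \<open>y\<close> bounds the squared norm of \<open>y\<close>
  by its product with \<open>x\<close>, which is at most the mean of the two squared norms.\<close>

lemma sum_squares_le_inverse_form:
  fixes S :: "nat \<Rightarrow> nat \<Rightarrow> real"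
  assumes sym: "\<And>i j. i < d \<Longrightarrow> j < d \<Longrightarrow> S i j = S j i" and \<kappa>: "\<kappa> > 0"
    and lower: "\<And>x. (\<Sum>i<d. (x i)\<^sup>2) \<le> (\<Sum>i<d. \<Sum>j<d. x i * S i j * x j)"
    and upper: "\<And>x. (\<Sum>i<d. \<Sum>j<d. x i * S i j * x j) \<le> \<kappa> * (\<Sum>i<d. (x i)\<^sup>2)"
    and x: "\<And>i. i < d \<Longrightarrow> x i = (\<Sum>j<d. S i j * y j)"
  shows "(\<Sum>i<d. (y i)\<^sup>2) \<le> (\<Sum>i<d. (x i)\<^sup>2)"
    and "(\<Sum>i<d. (x i)\<^sup>2) \<le> \<kappa> * (\<Sum>i<d. x i * y i)"
proof -
  define B where "B u v = (\<Sum>i<d. \<Sum>j<d. u i * S i j * v j)" for u v :: "nat \<Rightarrow> real"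
  have By: "B z y = (\<Sum>i<d. z i * x i)" for z
    by (simp add: B_def x sum_distrib_left mult.assoc)
  have "B y x = (\<Sum>j<d. \<Sum>i<d. y i * S i j * x j)"
    unfolding B_def by (rule sum.swap)
  also have "\<dots> = B x y"
    unfolding B_def by (intro sum.cong refl) (simp add: sym)
  finally have comm: "B y x = B x y" .
  have lo: "(\<Sum>i<d. (z i)\<^sup>2) \<le> B z z" and up: "B z z \<le> \<kappa> * (\<Sum>i<d. (z i)\<^sup>2)" for z
    unfolding B_def by (rule lower upper)+
  have "2 * (\<Sum>i<d. y i * x i) \<le> (\<Sum>i<d. (y i)\<^sup>2) + (\<Sum>i<d. (x i)\<^sup>2)"
    unfolding sum_distrib_left sum.distrib[symmetric]
  proof (rule sum_mono)
    fix i
    have "0 \<le> (y i - x i)\<^sup>2" by simp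
    then show "2 * (y i * x i) \<le> (y i)\<^sup>2 + (x i)\<^sup>2"
      by (simp add: power2_diff)
  qed
  then show "(\<Sum>i<d. (y i)\<^sup>2) \<le> (\<Sum>i<d. (x i)\<^sup>2)"
    using lo[of y] By[of y] by linarith
  have expand: "B (\<lambda>i. y i - c * x i) (\<lambda>i. y i - c * x i) = B y y - c * B y x - c * B x y + c\<^sup>2 * B x x" for c
    unfolding B_def sum_distrib_left sum_subtractf[symmetric] sum.distrib[symmetric]
    by (intro sum.cong refl) (simp add: algebra_simps power2_eq_square)
  let ?w = "\<lambda>i. y i - 1 / \<kappa> * x i"
  \<comment> \<open>Expanding the form at \<open>y - x / \<kappa>\<close> gives the spectral bound without diagonalisation.\<close>
  have "0 \<le> (\<Sum>i<d. (?w i)\<^sup>2)"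
    by (simp add: sum_nonneg)
  also have "\<dots> \<le> B ?w ?w"
    by (rule lo)
  also have "B ?w ?w = B y y - B y x / \<kappa> - B x y / \<kappa> + B x x / \<kappa>\<^sup>2"
    unfolding expand by (simp add: power_one_over)
  also have "\<dots> \<le> B y y - 2 * (B x y / \<kappa>) + \<kappa> * (\<Sum>i<d. (x i)\<^sup>2) / \<kappa>\<^sup>2"
    using divide_right_mono[OF up[of x], of "\<kappa>\<^sup>2"] by (simp add: comm)
  also have "B x y = (\<Sum>i<d. (x i)\<^sup>2)"
    by (simp add: By power2_eq_square)
  also have "B y y = (\<Sum>i<d. x i * y i)"
    by (simp add: By mult.commute)
  finally have "(\<Sum>i<d. (x i)\<^sup>2) / \<kappa> \<le> (\<Sum>i<d. x i * y i)"
    using \<kappa> by (simp add: power2_eq_square)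
  then show "(\<Sum>i<d. (x i)\<^sup>2) \<le> \<kappa> * (\<Sum>i<d. x i * y i)"
    using \<kappa> by (simp add: field_simps)
qed

lemma loewner_le_imp_forms:
  assumes S: "S \<in> carrier_mat d d" and lo: "loewner_le d (1\<^sub>m d) S" and up: "loewner_le d S (\<kappa> \<cdot>\<^sub>m 1\<^sub>m d)"
  shows "transpose_mat S = S"
    and "(\<Sum>i<d. (x i)\<^sup>2) \<le> (\<Sum>i<d. \<Sum>j<d. x i * S $$ (i, j) * x j)"
    and "(\<Sum>i<d. \<Sum>j<d. x i * S $$ (i, j) * x j) \<le> \<kappa> * (\<Sum>i<d. (x i)\<^sup>2)"
proof -
  have one: "(\<Sum>i<d. \<Sum>j<d. x i * (c * (if i = j then 1 else 0)) * x j) = c * (\<Sum>i<d. (x i)\<^sup>2)" for c :: real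
  proof -
    have "(\<Sum>j<d. x i * (c * (if i = j then 1 else 0)) * x j) = c * (x i)\<^sup>2" if "i < d" for i
    proof -
      have "(\<Sum>j<d. x i * (c * (if i = j then 1 else 0)) * x j) = (\<Sum>j<d. if i = j then c * (x i)\<^sup>2 else 0)"
        by (intro sum.cong) (auto simp: power2_eq_square)
      then show ?thesis
        using that by simp
    qed
    then show ?thesis
      by (simp add: sum_distrib_left)
  qed
  have A: "S - 1\<^sub>m d \<in> carrier_mat d d" "transpose_mat (S - 1\<^sub>m d) = S - 1\<^sub>m d"
    using lo by (auto simp: loewner_le_def psd_def)
  show "transpose_mat S = S"
  proof (rule eq_matI)
    fix i j assume "i < dim_row S" "j < dim_col S"
    then have ij: "i < d" "j < d"
      using S by auto
    then have "transpose_mat (S - 1\<^sub>m d) $$ (i, j) = (S - 1\<^sub>m d) $$ (i, j)"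
      using A by simp
    then show "transpose_mat S $$ (i, j) = S $$ (i, j)"
      using S ij by (auto simp: eq_commute split: if_splits)
  qed (use S in auto)
  have "0 \<le> scalar_prod (Matrix.vec d x) ((S - 1\<^sub>m d) *\<^sub>v Matrix.vec d x)"
    using lo by (simp add: loewner_le_def psd_def)
  also have "\<dots> = (\<Sum>i<d. \<Sum>j<d. x i * (S - 1\<^sub>m d) $$ (i, j) * x j)"
    using S by (intro scalar_prod_mult_mat_vec_eq_sum minus_carrier_mat) auto
  also have "\<dots> = (\<Sum>i<d. \<Sum>j<d. x i * S $$ (i, j) * x j - x i * (1 * (if i = j then 1 else 0)) * x j)"
    using S by (intro sum.cong refl) (auto simp: algebra_simps)
  finally show "(\<Sum>i<d. (x i)\<^sup>2) \<le> (\<Sum>i<d. \<Sum>j<d. x i * S $$ (i, j) * x j)"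
    by (simp only: sum_subtractf one)
  have "0 \<le> scalar_prod (Matrix.vec d x) ((\<kappa> \<cdot>\<^sub>m 1\<^sub>m d - S) *\<^sub>v Matrix.vec d x)"
    using up by (simp add: loewner_le_def psd_def)
  also have "\<dots> = (\<Sum>i<d. \<Sum>j<d. x i * (\<kappa> \<cdot>\<^sub>m 1\<^sub>m d - S) $$ (i, j) * x j)"
    using S by (intro scalar_prod_mult_mat_vec_eq_sum minus_carrier_mat) auto
  also have "\<dots> = (\<Sum>i<d. \<Sum>j<d. x i * (\<kappa> * (if i = j then 1 else 0)) * x j - x i * S $$ (i, j) * x j)"
    using S by (intro sum.cong refl) (auto simp: algebra_simps)
  finally show "(\<Sum>i<d. \<Sum>j<d. x i * S $$ (i, j) * x j) \<le> \<kappa> * (\<Sum>i<d. (x i)\<^sup>2)"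
    by (simp only: sum_subtractf one)
qed

text \<open>Justifies \<open>the (mat_inverse \<Sigma>)\<close> in \<open>gaussian_weight\<close>:
  the lower bound on the form excludes a nonzero kernel vector, so the matrix is a unit and the
  inversion returns a result.\<close>

lemma mat_inverse_positive_definite:
  assumes S: "S \<in> carrier_mat d d"
    and pos: "\<And>x. (\<Sum>i<d. (x i)\<^sup>2) \<le> (\<Sum>i<d. \<Sum>j<d. x i * S $$ (i, j) * x j :: real)"
  obtains P where "mat_inverse S = Some P" "P \<in> carrier_mat d d" "S * P = 1\<^sub>m d" "P * S = 1\<^sub>m d"
proof -
  have "Determinant.det S \<noteq> 0"
  proof
    assume "Determinant.det S = 0"
    then obtain v where v: "v \<in> carrier_vec d" "v \<noteq> 0\<^sub>v d" "S *\<^sub>v v = 0\<^sub>v d"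
      using det_0_iff_vec_prod_zero_field[OF S] by blast
    have vv: "Matrix.vec d (\<lambda>i. vec_index v i) = v"
      using v by auto
    have "(\<Sum>i<d. (vec_index v i)\<^sup>2) \<le> scalar_prod v (S *\<^sub>v v)"
      using pos[of "\<lambda>i. vec_index v i"] scalar_prod_mult_mat_vec_eq_sum[OF S, of "\<lambda>i. vec_index v i" "\<lambda>i. vec_index v i"]
      unfolding vv by simp
    also have "\<dots> = 0"
      using v by simp
    finally have "(\<Sum>i<d. (vec_index v i)\<^sup>2) = 0"
      by (simp add: antisym sum_nonneg)
    then have "\<forall>i<d. vec_index v i = 0"
      by (simp add: sum_nonneg_eq_0_iff)
    then have "v = 0\<^sub>v d"
      using v by (intro eq_vecI) auto
    with v show False
      by simp
  qed
  then have "S \<in> Units (ring_mat TYPE(real) d ())"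
    by (rule det_non_zero_imp_unit[OF S])
  then obtain P where P: "mat_inverse S = Some P"
    using mat_inverse(1)[OF S, where b="()"] by (cases "mat_inverse S") auto
  then show thesis
    using that mat_inverse(2)[OF S P] by blast
qed

lemma quadratic_form_mat_inverse:
  assumes S: "S \<in> carrier_mat d d" and lo: "loewner_le d (1\<^sub>m d) S" and up: "loewner_le d S (\<kappa> \<cdot>\<^sub>m 1\<^sub>m d)"
    and \<kappa>: "\<kappa> > 0"
  obtains P where "mat_inverse S = Some P" "P \<in> carrier_mat d d" "quadratic_form d (\<lambda>i j. P $$ (i, j)) \<kappa>"
proof -
  note forms = loewner_le_imp_forms[OF S lo up]
  obtain P where P: "mat_inverse S = Some P" "P \<in> carrier_mat d d" "S * P = 1\<^sub>m d" "P * S = 1\<^sub>m d"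
    using mat_inverse_positive_definite[OF S forms(2)] by blast
  \<comment> \<open>Transposing \<open>P * S = 1\<^sub>m d\<close> makes
    \<open>transpose_mat P\<close> a right inverse of the symmetric matrix \<open>S\<close>; it
    therefore equals the left inverse \<open>P\<close>.\<close>
  have SPt: "S * transpose_mat P = 1\<^sub>m d"
    using transpose_mult[OF P(2) S] forms(1) P(4) by simp
  have "transpose_mat P = (P * S) * transpose_mat P"
    using P by simp
  also have "\<dots> = P * (S * transpose_mat P)"
    using S P by (intro assoc_mult_mat) auto
  also have "\<dots> = P"
    using P SPt by simp
  finally have Pt: "transpose_mat P = P" .
  have Psym: "P $$ (i, j) = P $$ (j, i)" if "i < d" "j < d" for i j
    using arg_cong[OF Pt, of "\<lambda>A. A $$ (i, j)"] that P by simp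
  have Ssym: "S $$ (i, j) = S $$ (j, i)" if "i < d" "j < d" for i j
    using arg_cong[OF forms(1), of "\<lambda>A. A $$ (i, j)"] that S by simp
  have inv: "x i = (\<Sum>j<d. S $$ (i, j) * (\<Sum>k<d. P $$ (j, k) * x k))" if "i < d" for x i
  proof -
    have "S *\<^sub>v (P *\<^sub>v Matrix.vec d x) = Matrix.vec d x"
      using S P by (simp add: assoc_mult_mat_vec[symmetric])
    then have "x i = vec_index (S *\<^sub>v (P *\<^sub>v Matrix.vec d x)) i"
      using that by simp
    also have "\<dots> = (\<Sum>j<d. S $$ (i, j) * (\<Sum>k<d. P $$ (j, k) * x k))"
      using S P that by (simp add: scalar_prod_def lessThan_atLeast0)
    finally show ?thesis .
  qed
  have "quadratic_form d (\<lambda>i j. P $$ (i, j)) \<kappa>"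
  proof
    fix x :: "nat \<Rightarrow> real"
    note * = sum_squares_le_inverse_form[of d "\<lambda>i j. S $$ (i, j)" \<kappa> x "\<lambda>j. \<Sum>k<d. P $$ (j, k) * x k",
        OF Ssym \<kappa> forms(2,3) inv]
    show "(\<Sum>i<d. (\<Sum>j<d. P $$ (i, j) * x j)\<^sup>2) \<le> (\<Sum>i<d. (x i)\<^sup>2)"
      by (rule *(1))
    show "(\<Sum>i<d. (x i)\<^sup>2) \<le> \<kappa> * (\<Sum>i<d. \<Sum>j<d. x i * P $$ (i, j) * x j)"
      using *(2) by (simp add: sum_distrib_left mult.assoc)
  qed (use Psym \<kappa> in auto)
  with P that show thesis
    by blast
qed

text \<open>\<open>gaussian\<close> normalises by a Bochner integral, \<open>G\<close> by a
  nonnegative one; the two agree since \<open>Z 1\<close> is finite and positive.\<close>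

lemma (in quadratic_form) gaussian_eq_G:
  assumes P: "mat_inverse S = Some P" "P \<in> carrier_mat d d" "\<And>i j. Q i j = P $$ (i, j)"
  shows "gaussian d m S = G m 1"
proof -
  have w: "gaussian_weight d m S x = weight m 1 x" for x
    using scalar_prod_mult_mat_vec_eq_sum[OF P(2), of "\<lambda>i. x i - m i" "\<lambda>i. x i - m i"]
    by (simp add: gaussian_weight_def weight_def bil_def P)
  have Z: "(\<integral>y. weight m 1 y \<partial>lborel_Rd d) = enn2real (Z 1)"
    by (subst integral_eq_nn_integral) (auto simp: nn_integral_weight less_imp_le[OF weight_pos])
  have "Z 1 = ennreal (enn2real (Z 1))" "enn2real (Z 1) > 0"
    using Z_finite[of 1] Z_pos[of 1] by (auto simp: enn2real_positive_iff)
  then show ?thesis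
    unfolding gaussian_def G_def w Z using weight_pos
    by (metis divide_ennreal less_imp_le)
qed

lemma gaussian_class_cases:
  assumes D: "D \<in> gaussian_class d \<kappa> R" and \<kappa>: "\<kappa> > 0"
  obtains Q m where "quadratic_form d Q \<kappa>" "D = quadratic_form.G d Q m 1" "(\<Sum>i<d. (m i)\<^sup>2) \<le> R\<^sup>2"
proof -
  obtain m S where D: "D = gaussian d m S" and S: "S \<in> carrier_mat d d"
      "loewner_le d (1\<^sub>m d) S" "loewner_le d S (\<kappa> \<cdot>\<^sub>m 1\<^sub>m d)" and m: "L2_set m {..<d} \<le> R"
    using D unfolding gaussian_class_def by blast
  obtain P where P: "mat_inverse S = Some P" "P \<in> carrier_mat d d" and q: "quadratic_form d (\<lambda>i j. P $$ (i, j)) \<kappa>"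
    using quadratic_form_mat_inverse[OF S \<kappa>] by blast
  have "D = quadratic_form.G d (\<lambda>i j. P $$ (i, j)) m 1"
    unfolding D by (rule quadratic_form.gaussian_eq_G[OF q P refl])
  moreover have "(\<Sum>i<d. (m i)\<^sup>2) \<le> R\<^sup>2"
    using m unfolding L2_set_def by (rule sqrt_le_D)
  ultimately show thesis
    using q that by blast
qed

text \<open>For \<kappa> below 1 the two Loewner bounds contradict each other at the all-ones
  vector.\<close>

lemma gaussian_class_empty:
  assumes "d \<ge> 1" "\<kappa> < 1"
  shows "gaussian_class d \<kappa> R = {}"
proof -
  have False if S: "S \<in> carrier_mat d d" "loewner_le d (1\<^sub>m d) S" "loewner_le d S (\<kappa> \<cdot>\<^sub>m 1\<^sub>m d)" for S
  proof -
    have "(\<Sum>i<d. (1::real)\<^sup>2) \<le> \<kappa> * (\<Sum>i<d. (1::real)\<^sup>2)"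
      using loewner_le_imp_forms(2,3)[OF S, of "\<lambda>_. 1"] by (rule order_trans)
    then show False
      using assms by simp
  qed
  then show ?thesis
    unfolding gaussian_class_def by blast
qed

section \<open>Choice of the sample size\<close>

text \<open>There are \<open>(m\<^sup>2 + m) / 2\<close> positive and \<open>(m\<^sup>2 - m) / 2\<close> negative signs, so the sum is \<open>m / m\<close>.\<close>

definition balanced_sign :: "nat \<Rightarrow> nat \<Rightarrow> real" where
  "balanced_sign m j = (if j < (m * m + m) div 2 then 1 else -1) / real m"

lemma balanced_sign_nonzero: "m \<ge> 1 \<Longrightarrow> balanced_sign m j \<noteq> 0"
  by (simp add: balanced_sign_def)

lemma balanced_sign_square: "(balanced_sign m j)\<^sup>2 = 1 / real (m * m)"
  by (simp add: balanced_sign_def power2_eq_square)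

lemma sum_balanced_sign_square: "m \<ge> 1 \<Longrightarrow> (\<Sum>j<m * m. (balanced_sign m j)\<^sup>2) = 1"
  by (simp add: balanced_sign_square)

lemma sum_balanced_sign:
  assumes m: "m \<ge> 1"
  shows "(\<Sum>j<m * m. balanced_sign m j) = 1"
proof -
  let ?k = "(m * m + m) div 2"
  \<comment> \<open>The numbers \<open>m * m\<close> and \<open>m\<close> have the same parity, so
    halving their sum is exact; this is why the sample size is a perfect square.\<close>
  have k: "2 * ?k = m * m + m"
    by simp
  have "m \<le> m * m"
    using m by simp
  then have km: "?k \<le> m * m"
    by linarith
  have const: "(\<Sum>j<i. 2 / real m) = real (2 * i) / real m" for i :: nat
    by simp
  have "(\<Sum>j<m * m. balanced_sign m j) = (\<Sum>j<m * m. (if j < ?k then 2 / real m else 0) - 1 / real m)"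
    unfolding balanced_sign_def by (intro sum.cong refl) (simp add: field_simps)
  also have "\<dots> = (\<Sum>j<m * m. if j < ?k then 2 / real m else 0) - real (m * m) * (1 / real m)"
    by (simp add: sum_subtractf)
  also have "(\<Sum>j<m * m. if j < ?k then 2 / real m else 0) = (\<Sum>j<?k. 2 / real m)"
    using km by (intro sum.mono_neutral_cong_right) auto
  also have "\<dots> = real (m * m + m) / real m"
    unfolding const k ..
  also have "\<dots> - real (m * m) * (1 / real m) = 1"
    using m by (simp add: field_simps)
  finally show ?thesis .
qed

lemma ln_le_two_sqrt:
  fixes x :: real
  assumes "x > 0"
  shows "ln x \<le> 2 * sqrt x"
proof -
  have "ln (sqrt x) \<le> sqrt x - 1"
    using assms by (intro ln_le_minus_one) simp
  then show ?thesis
    using assms by (simp add: ln_sqrt)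
qed

lemma ln_ge_one_minus_inverse:
  fixes x :: real
  assumes "x > 0"
  shows "1 - 1 / x \<le> ln x"
  using ln_le_minus_one[of "1 / x"] assms by (simp add: ln_div)

text \<open>The iterated logarithm is negative for \<delta> above 1/e, so positivity of
  \<open>L\<close> has to come from the sum: the arguments of the two outer logarithms are at least
  2 and 2/3. The last bound lets \<open>L\<close> pay for the logarithm of the sample size.\<close>

lemma log_factor_bounds:
  fixes d :: nat and \<alpha> \<epsilon> \<delta> :: real
  assumes d: "d \<ge> 1" and \<epsilon>: "0 < \<epsilon>" "\<epsilon> \<le> 1" and \<delta>: "0 < \<delta>" "\<delta> \<le> 1 / 2" and \<alpha>: "0 < \<alpha>" "\<alpha> \<le> 1 / 2"
  defines "L \<equiv> ln (real d / (\<alpha> * \<epsilon>)) + ln (ln (1 / \<delta>))"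
  defines "T \<equiv> sqrt (real d) / \<alpha> * (ln (1 / \<delta>) / \<epsilon>\<^sup>2)"
  shows "1 / 4 \<le> L" "1 \<le> T" "ln (T / \<alpha>) \<le> 4 * L"
proof -
  define l where "l = ln (1 / \<delta>)"
  define q where "q = real d / (\<alpha> * \<epsilon>)"
  have "ln 2 \<le> l"
    unfolding l_def using \<delta> by (subst ln_le_cancel_iff) (auto simp: field_simps)
  then have l: "2 / 3 \<le> l"
    using ln2_ge_two_thirds by linarith
  have \<alpha>\<epsilon>: "0 < \<alpha> * \<epsilon>" "\<alpha> * \<epsilon> \<le> 1 / 2"
    using mult_mono[of \<alpha> "1 / 2" \<epsilon> 1] \<alpha> \<epsilon> by auto
  have q: "q \<ge> 2"
    unfolding q_def using \<alpha>\<epsilon> d by (simp add: pos_le_divide_eq)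
  have L: "L = ln q + ln l"
    by (simp add: L_def l_def q_def)
  have "1 / 4 = 1 - 1 / (4 / 3 :: real)"
    by simp
  also have "\<dots> \<le> ln (4 / 3)"
    by (rule ln_ge_one_minus_inverse) simp
  also have "\<dots> \<le> ln (q * l)"
    using mult_mono[of 2 q "2 / 3" l] q l by (subst ln_le_cancel_iff) auto
  also have "\<dots> = L"
    using q l by (simp add: L ln_mult)
  finally show L4: "1 / 4 \<le> L" .
  \<comment> \<open>This gives \<open>ln l \<ge> - 1 / 2\<close>, which is at least
    \<open>- 2 * L\<close>; a negative iterated logarithm therefore costs only a constant
    factor.\<close>
  have "1 - 1 / (2 / 3) \<le> ln (2 / 3 :: real)"
    by (rule ln_ge_one_minus_inverse) simp
  also have "\<dots> \<le> ln l"
    using l by (subst ln_le_cancel_iff) auto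
  finally have "ln q \<le> 3 * L"
    using L L4 by simp
  then have qL: "2 * ln q + ln l \<le> 4 * L"
    using L by simp
  have \<epsilon>2: "\<epsilon>\<^sup>2 \<le> 1" "0 < \<epsilon>\<^sup>2"
    using \<epsilon> by (auto simp: power_le_one)
  have "1 \<le> sqrt (real d)"
    using d by simp
  then have "2 * \<alpha> \<le> sqrt (real d)"
    using \<alpha> by linarith
  then have "2 \<le> sqrt (real d) / \<alpha>"
    using \<alpha> by (simp add: pos_le_divide_eq)
  moreover have "2 / 3 \<le> l / \<epsilon>\<^sup>2"
    using l \<epsilon>2 by (simp add: pos_le_divide_eq)
  ultimately have "2 * (2 / 3) \<le> T"
    unfolding T_def l_def by (intro mult_mono) auto
  then show T: "1 \<le> T"
    by simp
  have "sqrt (real d) \<le> real d"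
    using d by (intro real_le_lsqrt) (auto simp: power2_eq_square)
  also have "\<dots> \<le> (real d)\<^sup>2"
    using d by (simp add: power2_eq_square)
  finally have "sqrt (real d) * (l / (\<alpha> * \<epsilon>)\<^sup>2) \<le> (real d)\<^sup>2 * (l / (\<alpha> * \<epsilon>)\<^sup>2)"
    using l by (intro mult_right_mono) auto
  then have "T / \<alpha> \<le> q\<^sup>2 * l"
    by (simp add: T_def q_def l_def power_mult_distrib power_divide power2_eq_square mult_ac)
  then have "ln (T / \<alpha>) \<le> ln (q\<^sup>2 * l)"
    using T \<alpha> q l by (subst ln_le_cancel_iff) auto
  also have "\<dots> = 2 * ln q + ln l"
    using q l by (simp add: ln_mult ln_realpow)
  finally show "ln (T / \<alpha>) \<le> 4 * L"
    using qL by simp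
qed

text \<open>The last inequality has \<open>m * m\<close> on both sides. A multiple of
  \<open>X * T\<close> is tried for it, and its logarithm on the left, multiplied by \<kappa>, is
  absorbed into a multiple of \<open>X\<close>.\<close>

lemma sample_size_exists:
  fixes d :: nat and \<kappa> R L T \<alpha> :: real
  assumes d: "d \<ge> 1" and \<kappa>: "\<kappa> \<ge> 1" and \<alpha>: "0 < \<alpha>"
    and L: "1 / 4 \<le> L" and T: "1 \<le> T" and TL: "ln (T / \<alpha>) \<le> 4 * L"
  obtains m :: nat where "m \<ge> 1"
    "real (m * m) \<le> 2 ^ 19 * ((R\<^sup>2 + \<kappa>\<^sup>2 * real d * L) * T)"
    "128 * (2 * R\<^sup>2 + 2 * (4 * \<kappa> * (real d * ln 2 / 2 + ln (2 * real (m * m) / \<alpha>)))) * T \<le> real (m * m)"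
proof -
  define X where "X = R\<^sup>2 + \<kappa>\<^sup>2 * real d * L"
  have k2: "\<kappa> \<le> \<kappa>\<^sup>2"
    using \<kappa> by (simp add: power2_eq_square)
  have d1: "1 \<le> real d"
    using d by simp
  have "\<kappa>\<^sup>2 * real d * (1 / 4) \<le> \<kappa>\<^sup>2 * real d * L"
    using L by (intro mult_left_mono) auto
  then have X4: "\<kappa>\<^sup>2 * real d \<le> 4 * X"
    by (simp add: X_def add_increasing)
  have k2d: "\<kappa>\<^sup>2 \<le> \<kappa>\<^sup>2 * real d"
    using d1 by (simp add: mult_le_cancel_left1)
  have kX: "\<kappa> \<le> 4 * X" and k2X: "\<kappa>\<^sup>2 \<le> 4 * X"
    using k2 k2d X4 by linarith+
  have kdX: "\<kappa> * real d \<le> 4 * X"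
    using mult_right_mono[OF k2, of "real d"] X4 by linarith
  have kLX: "\<kappa> * L \<le> X"
  proof -
    have "\<kappa> * L \<le> \<kappa>\<^sup>2 * real d * L"
      using k2 k2d L by (intro mult_right_mono) auto
    then show ?thesis
      by (simp add: X_def add_increasing)
  qed
  have X0: "1 / 4 \<le> X" "R\<^sup>2 \<le> X"
    using kX \<kappa> L by (auto simp: X_def)
  \<comment> \<open>This is where \<kappa>^2 is spent: both \<kappa> and \<open>ln X\<close> are at
    most \<open>2 * sqrt X\<close>.\<close>
  have klnX: "\<kappa> * ln X \<le> 4 * X"
  proof -
    have "\<kappa> \<le> sqrt (4 * X)"
      using k2X \<kappa> by (intro real_le_rsqrt) auto
    then have k: "\<kappa> \<le> 2 * sqrt X"
      by (simp add: real_sqrt_mult)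
    have "\<kappa> * ln X \<le> \<kappa> * (2 * sqrt X)"
      using ln_le_two_sqrt[of X] X0 \<kappa> by (intro mult_left_mono) auto
    also have "\<dots> \<le> (2 * sqrt X) * (2 * sqrt X)"
      using k X0 by (intro mult_right_mono) auto
    also have "\<dots> = 4 * X"
      using X0 by simp
    finally show ?thesis .
  qed
  \<comment> \<open>The left side will come to at most 128 * (2 + 8 * 90) * X * T, and 128 * 722
    lies below 2^17. As \<open>sqrt M \<ge> 1\<close>, rounding the root up at most doubles it, so
    the sample size is at most 4 * M; hence 2^19.\<close>
  define M where "M = 2 ^ 17 * (X * T)"
  define m where "m = nat \<lceil>sqrt M\<rceil>"
  have XT: "1 / 4 \<le> X * T"
    using mult_mono[of "1 / 4" X 1 T] X0 T by simp
  then have M: "1 \<le> M"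
    by (simp add: M_def)
  then have s: "1 \<le> sqrt M"
    by simp
  have m_ge: "sqrt M \<le> real m"
    unfolding m_def by (rule real_nat_ceiling_ge)
  have m_le: "real m \<le> 2 * sqrt M"
    unfolding m_def using s by linarith
  have n_ge: "M \<le> real (m * m)"
    using mult_mono[OF m_ge m_ge] M by simp
  have n_le: "real (m * m) \<le> 4 * M"
    using mult_mono[OF m_le m_le] M by simp
  have n0: "real (m * m) > 0"
    using n_ge M by linarith
  let ?l = "ln (2 * real (m * m) / \<alpha>)"
  \<comment> \<open>The exponent 20 combines 2^17 in \<open>M\<close>, the factor 4 from rounding
    and the factor 2 in the logarithm.\<close>
  have "?l \<le> ln (2 ^ 20 * (X * (T / \<alpha>)))"
  proof (subst ln_le_cancel_iff)
    show "2 * real (m * m) / \<alpha> \<le> 2 ^ 20 * (X * (T / \<alpha>))"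
      using divide_right_mono[OF n_le, of \<alpha>] \<alpha> by (simp add: M_def)
  qed (use n0 \<alpha> X0 T in auto)
  also have "\<dots> = 20 * ln 2 + (ln X + ln (T / \<alpha>))"
  proof -
    have "X > 0" "T / \<alpha> > 0"
      using X0 T \<alpha> by auto
    then show ?thesis
      by (simp only: ln_mult_pos ln_realpow mult_pos_pos zero_less_power zero_less_numeral of_nat_numeral)
  qed
  also have "\<dots> \<le> 20 + ln X + 4 * L"
    using TL ln_2_less_1 by linarith
  finally have l: "?l \<le> 20 + ln X + 4 * L" .
  have "\<kappa> * (real d * ln 2 / 2 + ?l) \<le> \<kappa> * (real d * 1 / 2 + (20 + ln X + 4 * L))"
    using \<kappa> l ln_2_less_1 by (intro mult_left_mono add_mono divide_right_mono) auto
  also have "\<dots> = \<kappa> * real d / 2 + 20 * \<kappa> + \<kappa> * ln X + 4 * (\<kappa> * L)"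
    by (simp add: algebra_simps)
  also have "\<dots> \<le> 90 * X"
    using kdX kX klnX kLX by linarith
  finally have "128 * (2 * R\<^sup>2 + 2 * (4 * \<kappa> * (real d * ln 2 / 2 + ?l))) \<le> 2 ^ 17 * X"
    using X0 by simp
  then have "128 * (2 * R\<^sup>2 + 2 * (4 * \<kappa> * (real d * ln 2 / 2 + ?l))) * T \<le> 2 ^ 17 * X * T"
    using T by (intro mult_right_mono) auto
  also have "\<dots> \<le> real (m * m)"
    using n_ge by (simp add: M_def)
  finally have 2: "128 * (2 * R\<^sup>2 + 2 * (4 * \<kappa> * (real d * ln 2 / 2 + ?l))) * T \<le> real (m * m)" .
  have 1: "real (m * m) \<le> 2 ^ 19 * ((R\<^sup>2 + \<kappa>\<^sup>2 * real d * L) * T)"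
    using n_le by (simp add: M_def X_def)
  have "m \<ge> 1"
    using m_ge s by linarith
  then show thesis
    using that 1 2 by blast
qed

text \<open>The subtracted term is the fourth power of the noise level. It is inversely proportional
  to \<open>d\<close>, which cancels against the exponent and leaves a bound free of the
  dimension.\<close>

lemma inverse_sqrt_power_le:
  fixes \<alpha> :: real and d :: nat
  assumes d: "d \<ge> 1" and \<alpha>: "0 < \<alpha>" "\<alpha> \<le> 1 / 2"
  shows "(1 / sqrt (1 - \<alpha>\<^sup>2 / (16 * real d))) ^ d \<le> 1 + (\<alpha> / 2)\<^sup>2"
proof -
  define u where "u = \<alpha>\<^sup>2 / (16 * real d)"
  have a2: "\<alpha>\<^sup>2 \<le> 1" "0 < \<alpha>\<^sup>2"
    using \<alpha> by (auto simp: power_le_one)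
  have u: "0 < u" "u \<le> 1 / 16"
    unfolding u_def using a2 d by (auto simp: field_simps)
  \<comment> \<open>The product is \<open>1 + u - 2 * u\<^sup>2\<close>, at least 1 for
    \<open>u\<close> up to 1/2.\<close>
  have "1 \<le> (1 - u) * (1 + 2 * u)"
    using u mult_left_mono[of u "1 / 2" u] by (simp add: algebra_simps)
  also have "\<dots> \<le> (1 - u) * exp (2 * u)"
    using u by (intro mult_left_mono) auto
  finally have "sqrt 1 \<le> sqrt ((1 - u) * exp (2 * u))"
    by (rule real_sqrt_le_mono)
  also have "\<dots> = sqrt (1 - u) * exp u"
    by (simp add: real_sqrt_mult exp_double)
  finally have "1 / sqrt (1 - u) \<le> exp u"
    using u by (simp add: pos_divide_le_eq mult.commute)
  then have "(1 / sqrt (1 - u)) ^ d \<le> exp u ^ d"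
    using u by (intro power_mono) auto
  also have "\<dots> = exp (\<alpha>\<^sup>2 / 16)"
    using d by (simp add: exp_of_nat_mult[symmetric] u_def)
  also have "\<dots> \<le> 1 + \<alpha>\<^sup>2 / 16 + (\<alpha>\<^sup>2 / 16)\<^sup>2"
    using a2 by (intro exp_bound) auto
  also have "\<dots> \<le> 1 + (\<alpha> / 2)\<^sup>2"
    using a2 mult_left_mono[of "\<alpha>\<^sup>2" 1 "\<alpha>\<^sup>2"] by (simp add: power_divide power2_eq_square)
  finally show ?thesis
    by (simp add: u_def)
qed

lemma gaussian_sampler_exists:
  fixes d :: nat and \<kappa> R \<epsilon> \<delta> \<alpha> :: real
  assumes d: "d \<ge> 1" and \<kappa>: "\<kappa> \<ge> 1" and \<epsilon>: "0 < \<epsilon>" "\<epsilon> \<le> 1" and \<delta>: "0 < \<delta>" "\<delta> \<le> 1 / 2"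
    and \<alpha>: "0 < \<alpha>" "\<alpha> \<le> 1 / 2"
  shows "\<exists>n A. sampler (Rd d) n A \<and> accurate (gaussian_class d \<kappa> R) n \<alpha> A \<and> diff_private (Rd d) n \<epsilon> \<delta> A \<and>
    real n \<le> 2 ^ 19 * ((R\<^sup>2 + \<kappa>\<^sup>2 * real d * (ln (real d / (\<alpha> * \<epsilon>)) + ln (ln (1 / \<delta>))))
                       * (sqrt (real d) / \<alpha> * (ln (1 / \<delta>) / \<epsilon>\<^sup>2)))"
proof -
  define T where "T = sqrt (real d) / \<alpha> * (ln (1 / \<delta>) / \<epsilon>\<^sup>2)"
  note bounds = log_factor_bounds[OF d \<epsilon> \<delta> \<alpha>, folded T_def]
  obtain m :: nat where m: "m \<ge> 1"
    "real (m * m) \<le> 2 ^ 19 * ((R\<^sup>2 + \<kappa>\<^sup>2 * real d * (ln (real d / (\<alpha> * \<epsilon>)) + ln (ln (1 / \<delta>)))) * T)"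
    "128 * (2 * R\<^sup>2 + 2 * (4 * \<kappa> * (real d * ln 2 / 2 + ln (2 * real (m * m) / \<alpha>)))) * T \<le> real (m * m)"
    using sample_size_exists[OF d \<kappa> \<alpha>(1) bounds] by metis
  define n where "n = m * m"
  \<comment> \<open>Solves
    \<open>n * sqrt 2 ^ d * exp (- r / (4 * \<kappa>)) = \<alpha> / 2\<close>, so that truncation
    uses exactly half of the allowed error.\<close>
  define r where "r = 4 * \<kappa> * (real d * ln 2 / 2 + ln (2 * real n / \<alpha>))"
  \<comment> \<open>Makes \<sigma>^4 equal to \<open>\<alpha>\<^sup>2 / (16 * d)\<close>, so that
    the chi-square divergence is at most \<open>(\<alpha> / 2)\<^sup>2\<close> and the noise uses
    the other half.\<close>
  define \<sigma> where "\<sigma> = sqrt (\<alpha> / (4 * sqrt (real d)))"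
  define A where "A = mechanism d \<sigma> (2 * R\<^sup>2 + 2 * r) n (balanced_sign m)"
  have n: "n > 0"
    using m(1) by (simp add: n_def)
  have sd: "sqrt (real d) \<ge> 1"
    using d by simp
  have \<sigma>2: "\<sigma>\<^sup>2 = \<alpha> / (4 * sqrt (real d))"
    using \<alpha> by (simp add: \<sigma>_def)
  have "\<alpha> < 4 * sqrt (real d)"
    using \<alpha> sd by linarith
  then have \<sigma>: "\<sigma> > 0" "\<sigma> < 1"
    using \<alpha> d by (auto simp: \<sigma>_def)
  have "\<sigma> ^ 4 = (\<sigma>\<^sup>2)\<^sup>2"
    by simp
  also have "\<dots> = \<alpha>\<^sup>2 / (16 * real d)"
    unfolding \<sigma>2 by (simp add: power_divide power_mult_distrib)
  finally have \<sigma>4: "\<sigma> ^ 4 = \<alpha>\<^sup>2 / (16 * real d)" .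
  have n1: "1 \<le> 2 * real n / \<alpha>"
    using n \<alpha> by (simp add: pos_le_divide_eq)
  have r0: "r \<ge> 0"
    using n1 \<kappa> by (simp add: r_def)
  have tail: "real n * (sqrt 2 ^ d * exp (- r / (4 * \<kappa>))) = \<alpha> / 2"
  proof -
    have "sqrt 2 ^ d = exp (real d * ln 2 / 2)"
    proof -
      have "sqrt 2 ^ d = exp (ln (sqrt 2)) ^ d"
        by simp
      also have "\<dots> = exp (real d * ln 2 / 2)"
        by (simp add: ln_sqrt exp_of_nat_mult[symmetric])
      finally show ?thesis .
    qed
    moreover have "- r / (4 * \<kappa>) = - (real d * ln 2 / 2) - ln (2 * real n / \<alpha>)"
      using \<kappa> by (simp add: r_def field_simps)
    ultimately have "sqrt 2 ^ d * exp (- r / (4 * \<kappa>)) = exp (- ln (2 * real n / \<alpha>))"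
      by (simp add: mult_exp_exp)
    also have "\<dots> = \<alpha> / (2 * real n)"
      using n1 \<alpha> n by (subst exp_minus, subst exp_ln) auto
    finally show ?thesis
      using n by simp
  qed
  have "sampler (Rd d) n A"
    unfolding sampler_def A_def using \<sigma> by (intro measurable_mechanism)
  moreover have "accurate (gaussian_class d \<kappa> R) n \<alpha> A"
    unfolding accurate_def
  proof
    fix D assume "D \<in> gaussian_class d \<kappa> R"
    moreover have "\<kappa> > 0"
      using \<kappa> by simp
    ultimately obtain Q \<mu> where Q: "quadratic_form d Q \<kappa>" and D: "D = quadratic_form.G d Q \<mu> 1" and \<mu>: "(\<Sum>i<d. (\<mu> i)\<^sup>2) \<le> R\<^sup>2"
      by (rule gaussian_class_cases)
    have "tv_dist D (output_dist n A D) \<le> 2 * (\<alpha> / 2)"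
      unfolding D A_def
    proof (rule quadratic_form.tv_dist_mechanism_le[OF Q \<sigma>])
      show "(1 / sqrt (1 - \<sigma> ^ 4)) ^ d \<le> 1 + (\<alpha> / 2)\<^sup>2"
        unfolding \<sigma>4 by (rule inverse_sqrt_power_le[OF d \<alpha>])
    qed (use \<alpha> n \<mu> tail balanced_sign_nonzero[OF m(1)] sum_balanced_sign[OF m(1)]
        sum_balanced_sign_square[OF m(1)] in \<open>auto simp: n_def\<close>)
    then show "tv_dist D (output_dist n A D) \<le> \<alpha>"
      by simp
  qed
  moreover have "diff_private (Rd d) n \<epsilon> \<delta> A"
    unfolding A_def
  proof (rule diff_private_mechanism[OF \<sigma>(1) \<epsilon> \<delta>])
    \<comment> \<open>Since \<open>T * \<sigma>\<^sup>2 * \<epsilon>\<^sup>2\<close> is a quarter of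
      \<open>ln (1 / \<delta>)\<close>, the constant 32 becomes 128.\<close>
    have "32 * (2 * R\<^sup>2 + 2 * r) * ln (1 / \<delta>) = 128 * (2 * R\<^sup>2 + 2 * r) * T * (\<sigma>\<^sup>2 * \<epsilon>\<^sup>2)"
      unfolding \<sigma>2 T_def using \<alpha> sd \<epsilon> by (simp add: field_simps)
    also have "\<dots> \<le> real n * (\<sigma>\<^sup>2 * \<epsilon>\<^sup>2)"
      using m(3) by (intro mult_right_mono) (auto simp: r_def n_def)
    finally show "32 * (2 * R\<^sup>2 + 2 * r) * ln (1 / \<delta>) \<le> real n * \<sigma>\<^sup>2 * \<epsilon>\<^sup>2"
      by simp
  qed (use r0 balanced_sign_square in \<open>auto simp: n_def\<close>)
  ultimately show ?thesis
    using m(2) unfolding n_def[symmetric] T_def by blast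
qed

theorem theorem33:
  shows "\<exists>C>0::real. \<forall>(d::nat)\<ge>1. \<forall>\<kappa>>0::real. \<forall>R>0::real.
    \<forall>\<epsilon>\<in>{0<..1::real}. \<forall>\<delta>\<in>{0<..1/2::real}. \<forall>\<alpha>\<in>{0<..1/2::real}.
      \<exists>(n::nat) A. sampler (Rd d) n A \<and>
        accurate (gaussian_class d \<kappa> R) n \<alpha> A \<and>
        diff_private (Rd d) n \<epsilon> \<delta> A \<and>
        real n \<le> C * ((R\<^sup>2 + \<kappa>\<^sup>2 * real d * (ln (real d / (\<alpha> * \<epsilon>)) + ln (ln (1 / \<delta>))))
                       * (sqrt (real d) / \<alpha>) * (ln (1 / \<delta>) / \<epsilon>\<^sup>2))"
proof (intro exI[of _ "2 ^ 19 :: real"] conjI allI impI ballI)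
  fix d :: nat and \<kappa> R \<epsilon> \<delta> \<alpha> :: real
  assume d: "d \<ge> 1" and \<kappa>: "\<kappa> > 0" and "R > 0"
    and "\<epsilon> \<in> {0<..1}" "\<delta> \<in> {0<..1/2}" "\<alpha> \<in> {0<..1/2}"
  then have \<epsilon>: "0 < \<epsilon>" "\<epsilon> \<le> 1" and \<delta>: "0 < \<delta>" "\<delta> \<le> 1 / 2" and \<alpha>: "0 < \<alpha>" "\<alpha> \<le> 1 / 2"
    by auto
  show "\<exists>(n::nat) A. sampler (Rd d) n A \<and>
        accurate (gaussian_class d \<kappa> R) n \<alpha> A \<and>
        diff_private (Rd d) n \<epsilon> \<delta> A \<and>
        real n \<le> 2 ^ 19 * ((R\<^sup>2 + \<kappa>\<^sup>2 * real d * (ln (real d / (\<alpha> * \<epsilon>)) + ln (ln (1 / \<delta>))))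
                       * (sqrt (real d) / \<alpha>) * (ln (1 / \<delta>) / \<epsilon>\<^sup>2))"
  proof (cases "\<kappa> \<ge> 1")
    case True
    show ?thesis
      using gaussian_sampler_exists[OF d True \<epsilon> \<delta> \<alpha>, of R] by (simp only: mult.assoc)
  next
    case False
    \<comment> \<open>The class is empty, so no samples are required: accuracy is vacuous, and empty
      datasets have no neighbours. It remains to see that the bound is nonnegative.\<close>
    have "sampler (Rd d) 0 (mechanism d 1 0 0 (\<lambda>_. 0))"
      using measurable_mechanism[of 1 d 0 0 "\<lambda>_. 0"] by (simp add: sampler_def)
    moreover have "accurate (gaussian_class d \<kappa> R) 0 \<alpha> (mechanism d 1 0 0 (\<lambda>_. 0))"
      using False d by (simp add: accurate_def gaussian_class_empty)
    moreover have "diff_private (Rd d) 0 \<epsilon> \<delta> (mechanism d 1 0 0 (\<lambda>_. 0))"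
      by (simp add: diff_private_def neighbors_def)
    moreover have "real 0 \<le> 2 ^ 19 * ((R\<^sup>2 + \<kappa>\<^sup>2 * real d * (ln (real d / (\<alpha> * \<epsilon>)) + ln (ln (1 / \<delta>))))
                       * (sqrt (real d) / \<alpha>) * (ln (1 / \<delta>) / \<epsilon>\<^sup>2))"
    proof -
      have "0 \<le> ln (real d / (\<alpha> * \<epsilon>)) + ln (ln (1 / \<delta>))" "0 \<le> ln (1 / \<delta>)"
        using log_factor_bounds(1)[OF d \<epsilon> \<delta> \<alpha>] \<delta> by auto
      then show ?thesis
        using \<alpha> by simp
    qed
    ultimately show ?thesis
      by blast
  qed
qed simp

end
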